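(* Let $M$ be a locally compact, metrizable absolute neighbourhood retract (for instance, a manifold), let $f : M \to M$ be a homeomorphism, and let $K \subseteq M$ be an attractor for $f$ with basin of attraction $\mathcal{A}(K)$. Assume that $f|_K : K \to K$ is homotopic to the identity ${\rm id}_K$. Then the inclusion $i : K \subseteq \mathcal{A}(K)$ is a shape equivalence.
   Context: Attractors: let $f : M \to M$ be a homeomorphism. An attractor for $f$ is a (nonempty) compact set $K \subseteq M$ with $f(K)=K$ that has a neighbourhood $U$ such that every compact set $C \subseteq U$ is attracted by $K$, i.e. for every neighbourhood $V$ of $K$ there exists $n_0 \in \mathbb{N}$ such that $f^n(C) \subseteq V$ for every $n \geq n_0$. The maximal neighbourhood $U$ with this property is an open invariant subset of $M$, called the basin of attraction $\mathcal{A}(K)$. Absolute neighbourhood retract (ANR) means absolute neighbourhood retract for the class of metrizable spaces. Shape is understood in the usual sense (Borsuk, Mardešić–Segal) for metrizable spaces: a shape morphism $X \to Y$ can be described as a natural transformation $[Y,\cdot\,] \to [X,\cdot\,]$ of the homotopy-class functors on the homotopy category of metrizable ANRs (equivalently, of polyhedra); a continuous map induces a shape morphism by precomposition; a map is a shape equivalence if it induces an isomorphism in the shape category. *)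

theory Defs
  imports "HOL-Analysis.Analysis"
begin

section \<open>Absolute neighbourhood retracts for metrizable spaces\<close>

text \<open>
  The usual definition quantifies over all metrizable spaces \<open>Y\<close> containing \<open>X\<close> (up to
  homeomorphism) as a closed subset. A definition in HOL has to fix the type of points of \<open>Y\<close>; the type
  \<open>'a \<Rightarrow> real\<close> loses nothing: by Kuratowski--Wojdyslawski a metric space \<open>X\<close> is homeomorphic to a closed
  subset of a convex set of bounded functions \<open>X \<rightarrow> \<real>\<close> (sup metric), and by Dugundji's extension
  theorem that convex set is an absolute extensor for metrizable spaces. So if \<open>X\<close> is a neighbourhood
  retract there, then it is one in every metrizable space in which it is closed. (The constant
  \<^const>\<open>ANR\<close> of HOL-Analysis only tests ambient spaces inside \<open>'a \<times> real\<close>, which is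
  adequate for subsets of Euclidean spaces but not in general.)
\<close>

definition ANR_space :: "'a topology \<Rightarrow> bool" where
  "ANR_space X \<longleftrightarrow> metrizable_space X \<and>
     (\<forall>(Y :: ('a \<Rightarrow> real) topology) S.
        metrizable_space Y \<and> closedin Y S \<and> subtopology Y S homeomorphic_space X \<longrightarrow>
        (\<exists>U. openin Y U \<and> S \<subseteq> U \<and> S retract_of_space (subtopology Y U)))"


section \<open>Attractors\<close>

definition nbhd_of :: "'a topology \<Rightarrow> 'a set \<Rightarrow> 'a set \<Rightarrow> bool" where
  "nbhd_of M K U \<longleftrightarrow> U \<subseteq> topspace M \<and> (\<exists>W. openin M W \<and> K \<subseteq> W \<and> W \<subseteq> U)"

definition attracted_nbhd :: "'a topology \<Rightarrow> ('a \<Rightarrow> 'a) \<Rightarrow> 'a set \<Rightarrow> 'a set \<Rightarrow> bool" where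
  "attracted_nbhd M f K U \<longleftrightarrow> nbhd_of M K U \<and>
     (\<forall>C. compactin M C \<and> C \<subseteq> U \<longrightarrow>
        (\<forall>V. nbhd_of M K V \<longrightarrow> (\<exists>n0. \<forall>n\<ge>n0. (f ^^ n) ` C \<subseteq> V)))"

definition attractor :: "'a topology \<Rightarrow> ('a \<Rightarrow> 'a) \<Rightarrow> 'a set \<Rightarrow> bool" where
  "attractor M f K \<longleftrightarrow> K \<noteq> {} \<and> compactin M K \<and> f ` K = K \<and> (\<exists>U. attracted_nbhd M f K U)"

text \<open>Greatest with respect to inclusion; that it exists is \<open>basin_greatest\<close> below.\<close>

definition basin :: "'a topology \<Rightarrow> ('a \<Rightarrow> 'a) \<Rightarrow> 'a set \<Rightarrow> 'a set" where
  "basin M f K = (GREATEST U. attracted_nbhd M f K U)"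


section \<open>Shape morphisms\<close>

definition homotopy_rel :: "'x topology \<Rightarrow> 'p topology \<Rightarrow> (('x \<Rightarrow> 'p) \<times> ('x \<Rightarrow> 'p)) set" where
  "homotopy_rel X P = {(g, h). homotopic_with (\<lambda>_. True) X P g h}"

definition homotopy_classes :: "'x topology \<Rightarrow> 'p topology \<Rightarrow> ('x \<Rightarrow> 'p) set set" where
  "homotopy_classes X P = {g. continuous_map X P g} // homotopy_rel X P"

text \<open>The functor \<open>[X, _]\<close> on maps: \<open>u : P \<rightarrow> Q\<close> sends the class of \<open>g\<close> to the class of \<open>u \<circ> g\<close>.\<close>

definition postcomp_class ::
    "'x topology \<Rightarrow> 'q topology \<Rightarrow> ('p \<Rightarrow> 'q) \<Rightarrow> ('x \<Rightarrow> 'p) set \<Rightarrow> ('x \<Rightarrow> 'q) set" where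
  "postcomp_class X Q u c = homotopy_rel X Q `` ((\<lambda>g. u \<circ> g) ` c)"

text \<open>
  Natural transformations \<open>[Y, _] \<rightarrow> [X, _]\<close> of functors on the homotopy category of metrizable ANRs.
  HOL cannot quantify over types inside a formula, so the ANRs are those whose points have a given
  type \<open>'p\<close>; a theorem in which \<open>'p\<close> is a type variable covers all of them. Isomorphisms for different \<open>'p\<close>
  are compatible: inverses of natural transformations are unique, and two types \<open>'p\<close>, \<open>'q\<close> are
  handled simultaneously by \<open>'p + 'q\<close>. Only the values of a transformation on ANRs and on homotopy
  classes are meaningful, hence the equality \<open>shape_eq\<close>.
\<close>

type_synonym ('x, 'y, 'p) class_transformation = "'p topology \<Rightarrow> ('y \<Rightarrow> 'p) set \<Rightarrow> ('x \<Rightarrow> 'p) set"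

definition shape_morphism ::
    "'x topology \<Rightarrow> 'y topology \<Rightarrow> ('x, 'y, 'p) class_transformation \<Rightarrow> bool" where
  "shape_morphism X Y \<tau> \<longleftrightarrow>
     (\<forall>P. ANR_space P \<longrightarrow> \<tau> P \<in> homotopy_classes Y P \<rightarrow> homotopy_classes X P) \<and>
     (\<forall>P Q u. ANR_space P \<and> ANR_space Q \<and> continuous_map P Q u \<longrightarrow>
        (\<forall>c \<in> homotopy_classes Y P.
           \<tau> Q (postcomp_class Y Q u c) = postcomp_class X Q u (\<tau> P c)))"

definition shape_eq ::
    "'y topology \<Rightarrow> ('x, 'y, 'p) class_transformation \<Rightarrow> ('x, 'y, 'p) class_transformation \<Rightarrow> bool" where
  "shape_eq Y \<sigma> \<tau> \<longleftrightarrow> (\<forall>P. ANR_space P \<longrightarrow> (\<forall>c \<in> homotopy_classes Y P. \<sigma> P c = \<tau> P c))"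

definition shape_id :: "('x, 'x, 'p) class_transformation" where
  "shape_id = (\<lambda>P c. c)"

text \<open>The composite of \<open>\<tau> : X \<rightarrow> Y\<close> followed by \<open>\<sigma> : Y \<rightarrow> Z\<close>; note the contravariance.\<close>

definition shape_comp ::
    "('y, 'z, 'p) class_transformation \<Rightarrow> ('x, 'y, 'p) class_transformation \<Rightarrow>
     ('x, 'z, 'p) class_transformation" where
  "shape_comp \<sigma> \<tau> = (\<lambda>P c. \<tau> P (\<sigma> P c))"

definition shape_isomorphism ::
    "'x topology \<Rightarrow> 'y topology \<Rightarrow> ('x, 'y, 'p) class_transformation \<Rightarrow> bool" where
  "shape_isomorphism X Y \<tau> \<longleftrightarrow> shape_morphism X Y \<tau> \<and>
     (\<exists>\<sigma>. shape_morphism Y X \<sigma> \<and>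
          shape_eq X (shape_comp \<sigma> \<tau>) shape_id \<and> shape_eq Y (shape_comp \<tau> \<sigma>) shape_id)"

definition induced_shape ::
    "'x topology \<Rightarrow> ('x \<Rightarrow> 'y) \<Rightarrow> ('x, 'y, 'p) class_transformation" where
  "induced_shape X i = (\<lambda>P c. homotopy_rel X P `` ((\<lambda>g. g \<circ> i) ` c))"

definition shape_equivalence ::
    "'p itself \<Rightarrow> 'x topology \<Rightarrow> 'y topology \<Rightarrow> ('x \<Rightarrow> 'y) \<Rightarrow> bool" where
  "shape_equivalence (_ :: 'p itself) X Y i \<longleftrightarrow>
     continuous_map X Y i \<and>
     shape_isomorphism X Y (induced_shape X i :: ('x, 'y, 'p) class_transformation)"


section \<open>Well-definedness of the basin\<close>

lemma basin_greatest:
  assumes lc: "locally_compact_space M" and met: "metrizable_space M"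
    and hom: "homeomorphic_map M M f" and att: "attractor M f K"
  shows "attracted_nbhd M f K (basin M f K)"
    and "attracted_nbhd M f K U \<Longrightarrow> U \<subseteq> basin M f K"
    and "openin M (basin M f K)"
    and "f ` basin M f K = basin M f K"
proof -
  have contn: "continuous_map M M (f ^^ n)" for n
  proof (induction n)
    case (Suc n)
    then show ?case
      using continuous_map_compose [OF _ homeomorphic_imp_continuous_map [OF hom]]
      by (metis funpow.simps(2))
  qed (simp add: id_def)
  have cK: "compactin M K"
    using att by (auto simp: attractor_def)
  obtain U0 where U0: "attracted_nbhd M f K U0"
    using att by (auto simp: attractor_def)
  obtain W where W: "openin M W" "K \<subseteq> W" "W \<subseteq> U0"
    using U0 by (auto simp: attracted_nbhd_def nbhd_of_def)
  have "Hausdorff_space M"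
    by (simp add: met metrizable_imp_Hausdorff_space)
  then have "neighbourhood_base_of (compactin M) M"
    using lc locally_compact_space_neighbourhood_base by blast
  then have "\<exists>A N. openin M A \<and> compactin M N \<and> x \<in> A \<and> A \<subseteq> N \<and> N \<subseteq> W" if "x \<in> K" for x
    using that W unfolding neighbourhood_base_of by blast
  then obtain A N where AN: "\<And>x. x \<in> K \<Longrightarrow> openin M (A x) \<and> compactin M (N x) \<and>
      x \<in> A x \<and> A x \<subseteq> N x \<and> N x \<subseteq> W"
    by metis
  obtain F where F: "finite F" "F \<subseteq> A ` K" "K \<subseteq> \<Union>F"
    using compactinD [OF cK, of "A ` K"] AN by auto
  obtain G where G: "finite G" "G \<subseteq> K" "F = A ` G"
    using finite_subset_image [OF F(1,2)] by blast
  define I where "I = (\<Union>x\<in>G. A x)"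
  define B where "B = (\<Union>x\<in>G. N x)"
  have I: "openin M I" "K \<subseteq> I" "I \<subseteq> B" "B \<subseteq> U0"
  proof -
    have GK: "openin M (A x)" "A x \<subseteq> N x" "N x \<subseteq> W" if "x \<in> G" for x
      using AN G(2) that by blast+
    show "openin M I"
      unfolding I_def using GK(1) by (intro openin_Union) auto
    show "K \<subseteq> I"
      using F(3) G(3) by (simp add: I_def)
    show "I \<subseteq> B"
      unfolding I_def B_def using GK(2) by (intro UN_mono) auto
    show "B \<subseteq> U0"
      unfolding B_def using GK(3) W(3) by (intro UN_least) (blast intro: subset_trans)
  qed
  have cB: "compactin M B"
    unfolding B_def using G(1,2) AN by (intro compactin_Union) auto
  define D where "D = {x \<in> topspace M. \<exists>n. (f ^^ n) x \<in> I}"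
  have D_eq: "D = (\<Union>n. {x \<in> topspace M. (f ^^ n) x \<in> I})"
    by (auto simp: D_def)
  have oD: "openin M D"
    unfolding D_eq using openin_continuous_map_preimage [OF contn I(1)] by blast
  have nI: "nbhd_of M K I"
    using I openin_subset by (force simp: nbhd_of_def)
  have KD: "K \<subseteq> D"
  proof
    fix x
    assume "x \<in> K"
    then have "x \<in> topspace M" "(f ^^ 0) x \<in> I"
      using I(2) compactin_subset_topspace [OF cK] by auto
    then show "x \<in> D"
      unfolding D_def by blast
  qed
  have DD: "attracted_nbhd M f K D"
    unfolding attracted_nbhd_def
  proof (intro conjI allI impI)
    show "nbhd_of M K D"
      using oD KD openin_subset by (auto simp: nbhd_of_def)
    fix C V
    assume C: "compactin M C \<and> C \<subseteq> D" and V: "nbhd_of M K V"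
    obtain m where m: "\<And>n. n \<ge> m \<Longrightarrow> (f ^^ n) ` B \<subseteq> V"
      using U0 cB I(4) V unfolding attracted_nbhd_def by blast
    define pre where "pre = (\<lambda>n. {x \<in> topspace M. (f ^^ n) x \<in> I})"
    have "\<And>n. openin M (pre n)"
      unfolding pre_def using openin_continuous_map_preimage [OF contn I(1)] by blast
    moreover have "C \<subseteq> \<Union> (range pre)"
      using C unfolding D_eq pre_def by auto
    ultimately obtain F where F: "finite F" "F \<subseteq> range pre" "C \<subseteq> \<Union>F"
      using compactinD [of M C "range pre"] C by auto
    obtain J where J: "finite J" "F = pre ` J"
      using finite_subset_image [OF F(1,2)] by blast
    define k where "k = Max (insert 0 J)"
    have k: "j \<le> k" if "j \<in> J" for j
      unfolding k_def using J(1) that by simp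
    show "\<exists>n0. \<forall>n\<ge>n0. (f ^^ n) ` C \<subseteq> V"
    proof (intro exI allI impI subsetI)
      fix n y
      assume n: "m + k \<le> n" and "y \<in> (f ^^ n) ` C"
      then obtain x where x: "x \<in> C" "y = (f ^^ n) x"
        by blast
      obtain j where j: "j \<in> J" "(f ^^ j) x \<in> I"
        using F(3) J(2) x(1) by (auto simp: pre_def)
      have "j \<le> n" "m \<le> n - j"
        using n k [OF j(1)] by linarith+
      then have "y = (f ^^ (n - j)) ((f ^^ j) x)"
        unfolding x(2) by (metis comp_apply funpow_add le_add_diff_inverse2)
      then show "y \<in> V"
        using m [OF \<open>m \<le> n - j\<close>] j(2) I(3) by blast
    qed
  qed
  have point: "\<exists>n0. \<forall>n\<ge>n0. (f ^^ n) x \<in> I" if U: "attracted_nbhd M f K U" and x: "x \<in> U" for U x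
  proof -
    have "compactin M {x}"
      using U x by (auto simp: attracted_nbhd_def nbhd_of_def)
    then have "\<exists>n0. \<forall>n\<ge>n0. (f ^^ n) ` {x} \<subseteq> I"
      using U x nI unfolding attracted_nbhd_def by (metis empty_subsetI insert_subset)
    then show ?thesis
      by simp
  qed
  have DU: "U \<subseteq> D" if U: "attracted_nbhd M f K U" for U
  proof
    fix x
    assume x: "x \<in> U"
    then have xM: "x \<in> topspace M"
      using U by (auto simp: attracted_nbhd_def nbhd_of_def)
    then show "x \<in> D"
      using point [OF U x] by (auto simp: D_def)
  qed
  have eq: "basin M f K = D"
    unfolding basin_def using DD DU by (intro Greatest_equality) auto
  show "attracted_nbhd M f K (basin M f K)" "openin M (basin M f K)"
    "attracted_nbhd M f K U \<Longrightarrow> U \<subseteq> basin M f K"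
    using DD DU oD eq by auto
  have fM: "f ` topspace M = topspace M"
    using hom homeomorphic_imp_surjective_map by blast
  have D_iff: "f x \<in> D \<longleftrightarrow> x \<in> D" if x: "x \<in> topspace M" for x
  proof
    assume "f x \<in> D"
    then obtain n where "(f ^^ n) (f x) \<in> I"
      by (auto simp: D_def)
    then have "(f ^^ Suc n) x \<in> I"
      by (simp add: funpow_swap1)
    then show "x \<in> D"
      using x unfolding D_def by blast
  next
    assume xD: "x \<in> D"
    then obtain n0 where "\<forall>n\<ge>n0. (f ^^ n) x \<in> I"
      using point [OF DD] by blast
    then have "(f ^^ Suc n0) x \<in> I"
      using le_Suc_eq by blast
    then have "(f ^^ n0) (f x) \<in> I"
      by (simp add: funpow_swap1)
    then show "f x \<in> D"
      using x fM unfolding D_def by blast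
  qed
  have "D \<subseteq> topspace M"
    by (auto simp: D_def)
  then have "f ` D = D"
    using D_iff fM by (auto simp: subset_iff image_iff set_eq_iff) metis
  then show "f ` basin M f K = basin M f K"
    by (simp add: eq)
qed

end

theory Submission
  imports Defs
begin

text \<open>
  By naturality it suffices to show that, for every ANR \<open>P\<close>, restriction
  \<open>[\<A>(K), P] \<rightarrow> [K, P]\<close> is bijective. Write \<open>A = \<A>(K)\<close> and replace \<open>f\<close> by an iterate \<open>F\<close> that
  maps a compact neighbourhood of \<open>K\<close> into its interior; then \<open>K\<close> has arbitrarily small closed
  neighbourhoods \<open>T\<close> with \<open>F(T) \<subseteq> int T\<close> and \<open>A = \<Union>\<^sub>k F\<^bsup>-k\<^esup>(T)\<close>.

  Telescope principle: a homotopy \<open>J\<close> on \<open>T\<close> with \<open>J\<^sub>0 = \<psi> \<circ> J\<^sub>1 \<circ> F\<close> extends to one on \<open>A\<close> with the same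
  property. On \<open>F\<^bsup>-1\<^esup>(T)\<close> start with the map \<open>\<psi> \<circ> J\<^sub>1 \<circ> F\<close> and extend \<open>J\<close> by the homotopy extension
  property; then iterate. Extending the homotopies together with the maps is what avoids a
  \<open>lim\<^sup>1\<close> obstruction.

  The homotopy \<open>h\<close> from \<open>id\<^sub>K\<close> to \<open>F|\<^sub>K\<close> satisfies \<open>F \<circ> h\<^sub>s \<simeq> h\<^sub>s \<circ> F\<close> relative to the ends, because both
  complete the path \<open>h\<close> to the boundary of the square \<open>(s, t) \<mapsto> h\<^sub>s \<circ> h\<^sub>t\<close>. So the telescope principle with
  \<open>\<psi> = F\<^bsup>-1\<^esup>\<close> extends \<open>h\<close> to a homotopy \<open>H\<close> from \<open>id\<^sub>A\<close> to \<open>F\<close>. Applied with \<open>\<psi> = id\<close> to \<open>g \<circ> H\<close>, where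
  \<open>g\<close> extends a given map \<open>K \<rightarrow> P\<close> to a neighbourhood of \<open>K\<close>, it gives surjectivity; applied on
  \<open>[0, 1] \<times> A\<close> relative to the ends, it gives injectivity.
\<close>

section \<open>Absolute neighbourhood retracts as neighbourhood extensors\<close>

text \<open>The ambient space built in \<open>ANR_space_extension\<close> has points in
  \<open>('p \<Rightarrow> real) \<times> real\<close>, whereas \<open>ANR_space\<close> tests
  ambient spaces with points in \<open>'p \<Rightarrow> real\<close>. An infinite type is
  equinumerous with its square, and a real number is coded by a constant function.\<close>

lemma inj_fun_real_prod:
  obtains \<iota> :: "('p \<Rightarrow> real) \<times> real \<Rightarrow> ('p \<Rightarrow> real)" where "inj \<iota>"
proof -
  have "infinite (range (\<lambda>c::real. \<lambda>_::'p. c))"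
    using infinite_UNIV_char_0 [where 'a=real] finite_imageD [of "\<lambda>c. \<lambda>_::'p. c" UNIV]
    by (auto simp: inj_on_def fun_eq_iff)
  then have "infinite (UNIV :: ('p \<Rightarrow> real) set)"
    using finite_subset subset_UNIV by blast
  then obtain b :: "('p \<Rightarrow> real) \<times> ('p \<Rightarrow> real) \<Rightarrow> ('p \<Rightarrow> real)" where "bij_betw b (UNIV \<times> UNIV) UNIV"
    using card_of_Times_same_infinite card_of_ordIso by blast
  then have "inj b"
    by (simp add: bij_betw_def)
  then have b: "b x = b y \<longleftrightarrow> x = y" for x y
    by (simp add: inj_eq)
  show thesis
    by (rule that [of "\<lambda>(\<phi>, s). b (\<phi>, \<lambda>_. s)"]) (auto intro!: injI simp: b dest: fun_cong)
qed

text \<open>Relabelling the points of \<open>Y\<close> by \<open>\<iota>\<close> turns it into a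
  space of the type tested by \<open>ANR_space\<close>. The retraction found there, followed by the
  inverse of the embedding, is a left inverse of \<open>E\<close> near its image.\<close>

lemma ANR_space_neighbourhood_retraction:
  fixes P :: "'p topology" and Y :: "'y topology" and \<iota> :: "'y \<Rightarrow> 'p \<Rightarrow> real"
  assumes ANR: "ANR_space P" and Y: "metrizable_space Y" and inj: "inj_on \<iota> (topspace Y)"
    and E: "embedding_map P Y E" and clo: "closedin Y (E ` topspace P)"
  obtains V r where "openin Y V" "E ` topspace P \<subseteq> V" "continuous_map (subtopology Y V) P r"
    "\<And>p. p \<in> topspace P \<Longrightarrow> r (E p) = p"
proof -
  define j where "j = inv_into (topspace Y) \<iota>"
  have j: "j (\<iota> y) = y" if "y \<in> topspace Y" for y
    using inj that by (simp add: j_def)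
  define Z where "Z = pullback_topology (\<iota> ` topspace Y) j Y"
  have topZ: "topspace Z = \<iota> ` topspace Y"
    using j by (auto simp: Z_def topspace_pullback_topology)
  have "continuous_map Y Y (j \<circ> \<iota>)"
    by (rule continuous_map_eq [OF continuous_map_id]) (simp add: j)
  then have "continuous_map Y Z \<iota>"
    unfolding Z_def by (rule continuous_map_pullback') auto
  moreover have "continuous_map Z Y j"
    using continuous_map_pullback [OF continuous_map_id, of "\<iota> ` topspace Y" j Y] by (simp add: Z_def)
  ultimately have hom: "homeomorphic_maps Y Z \<iota> j"
    using j topZ by (auto simp: homeomorphic_maps_def)
  then have homi: "homeomorphic_map Y Z \<iota>"
    using homeomorphic_maps_map by blast
  define S where "S = \<iota> ` E ` topspace P"
  have "embedding_map P Z (\<iota> \<circ> E)"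
    using E homi embedding_map_compose surjective_embedding_map by blast
  then have "homeomorphic_map P (subtopology Z S) (\<iota> \<circ> E)"
    by (simp add: embedding_map_def S_def image_comp)
  then obtain e where e: "homeomorphic_maps P (subtopology Z S) (\<iota> \<circ> E) e"
    using homeomorphic_map_maps by blast
  have "closedin Z S"
    unfolding S_def using homi clo homeomorphic_map_closedness_eq by blast
  moreover have "metrizable_space Z"
    using Y hom homeomorphic_metrizable_space homeomorphic_maps_imp_homeomorphic_space by blast
  moreover have "subtopology Z S homeomorphic_space P"
    using e homeomorphic_maps_imp_homeomorphic_space homeomorphic_space_sym by blast
  ultimately obtain U where U: "openin Z U" "S \<subseteq> U" "S retract_of_space (subtopology Z U)"
    using ANR unfolding ANR_space_def by blast
  then obtain \<rho> where \<rho>: "continuous_map (subtopology Z U) (subtopology Z S) \<rho>" "\<And>x. x \<in> S \<Longrightarrow> \<rho> x = x"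
    by (auto simp: retract_of_space_def subtopology_subtopology Int_absorb1)
  define V where "V = {y \<in> topspace Y. \<iota> y \<in> U}"
  have "openin Y V"
    unfolding V_def using U(1) hom by (auto simp: homeomorphic_maps_def intro: openin_continuous_map_preimage)
  moreover have "E ` topspace P \<subseteq> topspace Y"
    using clo closedin_subset by blast
  then have "E ` topspace P \<subseteq> V"
    using U(2) by (auto simp: V_def S_def)
  moreover have "continuous_map (subtopology Y V) (subtopology Z U) \<iota>"
    using hom by (auto simp: homeomorphic_maps_def continuous_map_in_subtopology V_def
        intro: continuous_map_from_subtopology)
  then have "continuous_map (subtopology Y V) P (e \<circ> \<rho> \<circ> \<iota>)"
    using e \<rho>(1) by (auto simp: homeomorphic_maps_def intro!: continuous_map_compose)
  moreover have "(e \<circ> \<rho> \<circ> \<iota>) (E p) = p" if "p \<in> topspace P" for p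
    using e \<rho>(2) that by (auto simp: homeomorphic_maps_def S_def)
  ultimately show thesis
    using that by blast
qed

section \<open>Hausdorff's formula and extension of maps into an ANR\<close>

lemma INF_abs_diff_le:
  fixes u v :: "'i \<Rightarrow> real"
  assumes "I \<noteq> {}" and u: "\<And>i. i \<in> I \<Longrightarrow> 0 \<le> u i" and v: "\<And>i. i \<in> I \<Longrightarrow> 0 \<le> v i"
    and uv: "\<And>i. i \<in> I \<Longrightarrow> \<bar>u i - v i\<bar> \<le> c"
  shows "\<bar>(INF i\<in>I. u i) - (INF i\<in>I. v i)\<bar> \<le> c"
proof -
  have *: "(INF i\<in>I. f i) - c \<le> (INF i\<in>I. g i)"
    if "\<And>i. i \<in> I \<Longrightarrow> 0 \<le> f i" "\<And>i. i \<in> I \<Longrightarrow> \<bar>f i - g i\<bar> \<le> c" for f g :: "'i \<Rightarrow> real"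
  proof (rule cINF_greatest [OF \<open>I \<noteq> {}\<close>])
    fix i assume i: "i \<in> I"
    have "(INF i\<in>I. f i) \<le> f i"
      using i that(1) by (intro cINF_lower bdd_belowI2 [where m=0]) auto
    then show "(INF i\<in>I. f i) - c \<le> g i"
      using that(2) [OF i] by linarith
  qed
  from *[of u v] *[of v u] show ?thesis
    using u v uv by (simp add: abs_le_iff abs_minus_commute algebra_simps)
qed

text \<open>
  Hausdorff's formula \<open>q x p = inf\<^bsub>y \<in> L\<^esub> (d (g y) p + \<rho> x y / r x) - 1\<close> off \<open>L\<close>, where \<open>r\<close> is the distance to
  \<open>L\<close>. It extends \<open>x \<mapsto> d (g x)\<close> continuously in the uniform norm, for arbitrary metrizable spaces.
\<close>

lemma hausdorff_extension:
  assumes X: "Metric_space X \<rho>" and P: "Metric_space P d" and d1: "\<And>p q. d p q \<le> 1"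
    and L: "closedin (Metric_space.mtopology X \<rho>) L" "L \<noteq> {}"
    and g: "continuous_map (subtopology (Metric_space.mtopology X \<rho>) L) (Metric_space.mtopology P d) g"
  obtains q :: "'x \<Rightarrow> 'p \<Rightarrow> real" and r :: "'x \<Rightarrow> real"
  where "\<And>x p. x \<in> X \<Longrightarrow> p \<in> P \<Longrightarrow> 0 \<le> q x p" "\<And>x p. x \<in> X \<Longrightarrow> p \<in> P \<Longrightarrow> q x p \<le> 1"
    "\<And>x p. x \<in> L \<Longrightarrow> q x p = d (g x) p"
    "\<And>a \<epsilon>. a \<in> X \<Longrightarrow> 0 < \<epsilon> \<Longrightarrow> \<exists>\<delta>>0. \<forall>x\<in>X. \<rho> a x < \<delta> \<longrightarrow> (\<forall>p\<in>P. \<bar>q a p - q x p\<bar> \<le> \<epsilon>)"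
    "continuous_map (Metric_space.mtopology X \<rho>) euclideanreal r"
    "\<And>x. x \<in> X \<Longrightarrow> r x = 0 \<longleftrightarrow> x \<in> L"
proof -
  interpret X: Metric_space X \<rho> by fact
  interpret P: Metric_space P d by fact
  have LX: "L \<subseteq> X"
    using L(1) closedin_subset by force
  have gP: "g y \<in> P" if "y \<in> L" for y
    using g that LX by (auto simp: continuous_map_def)
  define r where "r x = (INF y\<in>L. \<rho> x y)" for x
  have r0: "0 \<le> r x" for x
    unfolding r_def using L(2) by (intro cINF_greatest) auto
  have rle: "r x \<le> \<rho> x y" if "y \<in> L" for x y
    unfolding r_def using that by (intro cINF_lower bdd_belowI2 [where m=0]) auto
  have rless: "\<exists>y\<in>L. \<rho> x y < c" if "r x < c" for x c
    using that L(2) unfolding r_def by (subst (asm) cINF_less_iff) (auto intro: bdd_belowI2 [where m=0])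
  have rlip: "\<bar>r x - r x'\<bar> \<le> \<rho> x x'" if "x \<in> X" "x' \<in> X" for x x'
    unfolding r_def using that L(2) LX
    by (intro INF_abs_diff_le) (auto, metis X.mdist_reverse_triangle X.commute subsetD)
  have rzero: "r x = 0 \<longleftrightarrow> x \<in> L" if x: "x \<in> X" for x
  proof
    show "x \<in> L \<Longrightarrow> r x = 0"
      using rle [of x x] r0 [of x] x by simp
    assume "r x = 0"
    show "x \<in> L"
    proof (rule ccontr)
      assume "x \<notin> L"
      then obtain e where "e > 0" "disjnt L (X.mball x e)"
        using L(1) x unfolding X.closedin_metric by blast
      moreover obtain y where "y \<in> L" "\<rho> x y < e"
        using rless [of x e] \<open>r x = 0\<close> \<open>e > 0\<close> by auto
      ultimately show False
        using x LX by (auto simp: disjnt_iff)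
    qed
  qed
  have rcont: "continuous_map X.mtopology euclideanreal r"
    unfolding mtopology_is_euclidean [symmetric]
    using X.metric_continuous_map [OF Met_TC.Metric_space_axioms, of r]
    by (simp add: dist_real_def) (metis rlip le_less_trans)
  \<comment> \<open>Hausdorff's infimum multiplied by \<open>r x\<close>, so that
    \<open>q = s / r - 1\<close> off \<open>L\<close>. Clearing the denominator makes
    \<open>s\<close> Lipschitz in \<open>x\<close>, uniformly in \<open>p\<close>.\<close>
  define s where "s x p = (INF y\<in>L. r x * d (g y) p + \<rho> x y)" for x p
  have sle: "s x p \<le> r x * d (g y) p + \<rho> x y" if "y \<in> L" for x y p
    unfolding s_def using that r0 by (intro cINF_lower bdd_belowI2 [where m=0]) auto
  have sge: "r x \<le> s x p" for x p
    unfolding s_def using L(2) r0 by (intro cINF_greatest) (auto intro: add_nonneg_nonneg add_increasing rle)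
  have s2: "s x p \<le> 2 * r x" for x p
  proof (rule ccontr)
    assume "\<not> s x p \<le> 2 * r x"
    then obtain y where "y \<in> L" "\<rho> x y < s x p - r x"
      using rless [of x "s x p - r x"] by auto
    moreover have "r x * d (g y) p \<le> r x"
      using d1 r0 by (simp add: mult_left_le)
    ultimately show False
      using sle [of y x p] by linarith
  qed
  have slip: "\<bar>s x p - s x' p\<bar> \<le> 2 * \<rho> x x'" if x: "x \<in> X" "x' \<in> X" for x x' p
    unfolding s_def
  proof (intro INF_abs_diff_le L(2))
    fix y assume y: "y \<in> L"
    have "\<bar>r x * d (g y) p - r x' * d (g y) p\<bar> = \<bar>r x - r x'\<bar> * d (g y) p"
      by (simp add: abs_mult left_diff_distrib flip: left_diff_distrib)
    also have "\<dots> \<le> \<rho> x x'"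
      using mult_mono [OF rlip [OF x] d1 [of "g y" p]] by simp
    finally have 1: "\<bar>r x * d (g y) p - r x' * d (g y) p\<bar> \<le> \<rho> x x'" .
    have "\<bar>\<rho> x y - \<rho> x' y\<bar> \<le> \<rho> x x'"
      using x y LX X.mdist_reverse_triangle X.commute by (metis subsetD)
    with 1 show "\<bar>r x * d (g y) p + \<rho> x y - (r x' * d (g y) p + \<rho> x' y)\<bar> \<le> 2 * \<rho> x x'"
      by linarith
  qed (auto simp: r0)
  define q where "q x p = (if x \<in> L then d (g x) p else s x p / r x - 1)" for x p
  have rpos: "0 < r x" if "x \<in> X" "x \<notin> L" for x
    using rzero [OF that(1)] that(2) r0 [of x] by linarith
  have q0: "0 \<le> q x p" and q1: "q x p \<le> 1" if "x \<in> X" "p \<in> P" for x p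
    using that(1) rpos [of x] sge [of x p] s2 [of x p] d1 by (auto simp: q_def field_simps)
  have near: "\<exists>\<delta>>0. \<forall>x\<in>X. \<rho> a x < \<delta> \<longrightarrow> (\<forall>p\<in>P. \<bar>q a p - q x p\<bar> \<le> \<epsilon>)"
    if a: "a \<in> X" "0 < \<epsilon>" for a \<epsilon>
  proof (cases "a \<in> L")
    case False
    define R where "R = r a"
    have R: "0 < R"
      using rpos a False by (simp add: R_def)
    \<comment> \<open>The first bound gives \<open>r x \<ge> R / 2\<close>, so \<open>x\<close>
      stays off \<open>L\<close>. The second bounds the numerator of the difference of the two
      quotients, at most \<open>4 * R * \<delta>\<close>, by
      \<open>\<epsilon> * R * r x\<close>.\<close>
    define \<delta> where "\<delta> = min (R / 2) (\<epsilon> * R / 8)"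
    have "\<bar>q a p - q x p\<bar> \<le> \<epsilon>" if x: "x \<in> X" "\<rho> a x < \<delta>" for x p
    proof -
      have \<delta>: "\<delta> \<le> R / 2" "8 * \<delta> \<le> \<epsilon> * R"
        unfolding \<delta>_def using min.cobounded2 [of "R / 2" "\<epsilon> * R / 8"] by auto
      have rx: "\<bar>R - r x\<bar> \<le> \<delta>"
        using rlip [OF a(1) x(1)] x(2) by (simp add: R_def)
      then have rx2: "R / 2 \<le> r x"
        using \<delta>(1) by linarith
      then have "x \<notin> L"
        using rzero [OF x(1)] R by auto
      have "\<bar>s a p * r x - s x p * R\<bar> = \<bar>s a p * (r x - R) + R * (s a p - s x p)\<bar>"
        by (simp add: algebra_simps)
      also have "\<dots> \<le> \<bar>s a p\<bar> * \<bar>r x - R\<bar> + R * \<bar>s a p - s x p\<bar>"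
        using R by (metis abs_mult abs_of_pos abs_triangle_ineq)
      also have "\<dots> \<le> (2 * R) * \<delta> + R * (2 * \<delta>)"
        using s2 [of a p] sge [of a p] R rx slip [OF a(1) x(1), of p] x(2)
        by (intro add_mono mult_mono) (auto simp: R_def abs_minus_commute)
      also have "\<dots> \<le> (\<epsilon> * R) * (R / 2)"
        using mult_right_mono [OF \<delta>(2), of "R/2"] R by (simp add: algebra_simps)
      also have "\<dots> \<le> \<epsilon> * R * r x"
        using rx2 R a(2) by (intro mult_left_mono) auto
      finally have "\<bar>s a p * r x - s x p * R\<bar> \<le> \<epsilon> * (R * r x)"
        by (simp add: mult.assoc)
      moreover have "q a p - q x p = (s a p * r x - s x p * R) / (R * r x)"
        using \<open>x \<notin> L\<close> False R rx2 by (simp add: q_def R_def field_simps)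
      ultimately show ?thesis
        using R rx2 by (simp add: abs_divide abs_mult divide_le_eq)
    qed
    moreover have "\<delta> > 0"
      using R a(2) by (simp add: \<delta>_def)
    ultimately show ?thesis
      by blast
  next
    case True
    interpret S: Submetric X \<rho> L
      by (simp add: LX Submetric.intro Submetric_axioms.intro X.Metric_space_axioms)
    have "continuous_map S.sub.mtopology P.mtopology g"
      using g by (simp add: S.mtopology_submetric)
    then obtain \<eta> where \<eta>: "\<eta> > 0" "\<And>y. y \<in> L \<Longrightarrow> \<rho> a y < \<eta> \<Longrightarrow> d (g a) (g y) < \<epsilon> / 2"
      using True a(2) S.sub.metric_continuous_map [OF P] by (meson half_gt_zero)
    \<comment> \<open>Only points \<open>y\<close> of \<open>L\<close> with
      \<open>\<rho> x y < 2 * r x \<le> 2 * \<rho> a x\<close> matter for the infimum; for these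
      \<open>\<rho> a y < 3 * \<eta> / 4\<close>, where \<open>g\<close> is controlled.\<close>
    define \<delta> where "\<delta> = \<eta> / 4"
    have "\<bar>q a p - q x p\<bar> \<le> \<epsilon>" if x: "x \<in> X" "\<rho> a x < \<delta>" and p: "p \<in> P" for x p
    proof -
      have gap: "\<bar>d (g a) p - d (g y) p\<bar> \<le> \<epsilon> / 2" if "y \<in> L" "\<rho> a y < \<eta>" for y
        using \<eta>(2) [OF that] P.mdist_reverse_triangle [OF gP [OF True] p gP [OF that(1)]]
          P.commute by (smt (verit) P.triangle gP True p that(1))
      show ?thesis
      proof (cases "x \<in> L")
        case xL: True
        then have "\<rho> a x < \<eta>"
          using x(2) \<eta>(1) by (simp add: \<delta>_def)
        then show ?thesis
          using gap [OF xL] True xL a(2) by (simp add: q_def)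
      next
        case xL: False
        have R: "0 < r x" "r x \<le> \<rho> a x"
          using rpos x xL rle [OF True, of x] X.commute by auto
        have q_eq: "q a p - q x p = d (g a) p + 1 - s x p / r x"
          using True xL by (simp add: q_def)
        \<comment> \<open>Upper bound: test the infimum on a point \<open>y\<close> that nearly
          realises the distance \<open>r x\<close>.\<close>
        have "s x p / r x \<le> d (g a) p + 1 + \<epsilon>"
        proof -
          obtain y where y: "y \<in> L" "\<rho> x y < r x + min 1 (\<epsilon>/2) * r x"
            using rless [of x "r x + min 1 (\<epsilon>/2) * r x"] R(1) a(2) by auto
          have m: "min 1 (\<epsilon>/2) * r x \<le> 1 * r x" "min 1 (\<epsilon>/2) * r x \<le> \<epsilon>/2 * r x"
            using R(1) by (intro mult_right_mono; simp)+
          have "\<rho> a y \<le> \<rho> a x + \<rho> x y"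
            using X.triangle a(1) x(1) y(1) LX by blast
          then have "\<rho> a y < \<eta>"
            using y(2) m(1) R x(2) unfolding \<delta>_def by linarith
          then have "r x * d (g y) p \<le> r x * (d (g a) p + \<epsilon>/2)"
            using gap [OF y(1)] R(1) by (intro mult_left_mono) linarith+
          then have "s x p \<le> r x * (d (g a) p + \<epsilon>/2) + (r x + \<epsilon>/2 * r x)"
            using sle [OF y(1), of x p] y(2) m(2) by linarith
          also have "\<dots> = (d (g a) p + 1 + \<epsilon>) * r x"
            by (simp add: algebra_simps)
          finally show ?thesis
            using R(1) by (simp add: pos_divide_le_eq)
        qed
        moreover have "d (g a) p + 1 - \<epsilon> \<le> s x p / r x"
        proof -
          have "(d (g a) p + 1 - \<epsilon>) * r x \<le> s x p"
            unfolding s_def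
          proof (intro cINF_greatest L(2))
            fix y assume y: "y \<in> L"
            \<comment> \<open>Lower bound: either \<open>y\<close> is close enough to
              \<open>a\<close> for the continuity of \<open>g\<close>, or its distance to
              \<open>x\<close> alone already reaches the bound, since
              \<open>d \<le> 1\<close>.\<close>
            show "(d (g a) p + 1 - \<epsilon>) * r x \<le> r x * d (g y) p + \<rho> x y"
            proof (cases "\<rho> x y < 2 * r x")
              case True
              have "\<rho> a y \<le> \<rho> a x + \<rho> x y"
                using X.triangle a(1) x(1) y LX by blast
              then have "\<rho> a y < \<eta>"
                using True R x(2) unfolding \<delta>_def by linarith
              then have "(d (g a) p - \<epsilon>) * r x \<le> d (g y) p * r x"
                using gap [OF y] R(1) a(2) by (intro mult_right_mono) linarith+
              then show ?thesis
                using rle [OF y, of x] by (simp add: algebra_simps)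
            next
              case False
              have "(d (g a) p + 1 - \<epsilon>) * r x \<le> 2 * r x"
                using d1 [of "g a" p] a(2) R(1) by (intro mult_right_mono) auto
              moreover have "0 \<le> r x * d (g y) p"
                using R(1) by simp
              ultimately show ?thesis
                using False by linarith
            qed
          qed
          then show ?thesis
            using R(1) by (simp add: pos_le_divide_eq)
        qed
        ultimately show ?thesis
          using q_eq by linarith
      qed
    qed
    then show ?thesis
      using \<eta>(1) by (intro exI [of _ \<delta>]) (auto simp: \<delta>_def)
  qed
  have qL: "q x p = d (g x) p" if "x \<in> L" for x p
    using that by (simp add: q_def)
  show thesis
    by (rule that [of q r]) (fact q0 q1 qL near rcont rzero)+
qed

text \<open>
  The Kuratowski image \<open>e(P)\<close> need not be closed among the bounded functions. It becomes closed in
  \<open>Y\<close>, which adds a real coordinate and keeps only \<open>e(P)\<close> at height \<open>0\<close>; \<open>X\<close> maps to \<open>Y\<close> because its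
  height \<open>r\<close> vanishes on \<open>L\<close> only.
\<close>

lemma ANR_space_extension:
  fixes P :: "'p topology" and X :: "'x topology"
  assumes ANR: "ANR_space P" and X: "metrizable_space X" and clo: "closedin X L"
    and g: "continuous_map (subtopology X L) P g"
  obtains U g' where "openin X U" "L \<subseteq> U" "continuous_map (subtopology X U) P g'"
    "\<And>x. x \<in> L \<Longrightarrow> g' x = g x"
proof (cases "L = {}")
  case True
  show thesis
    by (rule that [of "{}" g]) (use True g in auto)
next
  case False
  obtain A \<rho> where A: "Metric_space A \<rho>" and X_eq: "X = Metric_space.mtopology A \<rho>"
    using X by (auto simp: metrizable_space_def)
  obtain B d0 where B0: "Metric_space B d0" and P0: "P = Metric_space.mtopology B d0"
    using ANR by (auto simp: ANR_space_def metrizable_space_def)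
  \<comment> \<open>Capping by 1 keeps the topology, gives the bound required by Hausdorff's formula
    and makes all functions \<open>d p\<close> bounded.\<close>
  define d where "d = Metric_space.capped_dist d0 1"
  have B: "Metric_space B d" and P_eq: "P = Metric_space.mtopology B d" and d1: "\<And>p q. d p q \<le> 1"
    using Metric_space.capped_dist [OF B0, of 1] Metric_space.mtopology_capped_metric [OF B0, of 1]
    by (auto simp: d_def P0 Metric_space.capped_dist_def [OF B0])
  interpret A: Metric_space A \<rho> by fact
  interpret B: Metric_space B d by fact
  have topX: "topspace X = A" and topP: "topspace P = B"
    by (auto simp: X_eq P_eq)
  have LA: "L \<subseteq> A"
    using clo closedin_subset topX by blast
  have gB: "g x \<in> B" if "x \<in> L" for x
    using g that LA topX topP by (auto simp: continuous_map_def)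
  then have "B \<noteq> {}"
    using False by blast
  have g2: "continuous_map (subtopology A.mtopology L) B.mtopology g" "closedin A.mtopology L"
    using g clo by (auto simp: X_eq P_eq)
  obtain q r where q0: "\<And>x p. x \<in> A \<Longrightarrow> p \<in> B \<Longrightarrow> 0 \<le> q x p" and q1: "\<And>x p. x \<in> A \<Longrightarrow> p \<in> B \<Longrightarrow> q x p \<le> 1"
    and qL: "\<And>x p. x \<in> L \<Longrightarrow> q x p = d (g x) p"
    and qc: "\<And>a \<epsilon>. a \<in> A \<Longrightarrow> 0 < \<epsilon> \<Longrightarrow> \<exists>\<delta>>0. \<forall>x\<in>A. \<rho> a x < \<delta> \<longrightarrow> (\<forall>p\<in>B. \<bar>q a p - q x p\<bar> \<le> \<epsilon>)"
    and rc: "continuous_map A.mtopology euclideanreal r"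
    and r0: "\<And>x. x \<in> A \<Longrightarrow> r x = 0 \<longleftrightarrow> x \<in> L"
    by (rule hausdorff_extension [OF A B d1 g2(2) False g2(1)]) (rule that)
  \<comment> \<open>\<open>F\<close> with \<open>D\<close> is the space of bounded functions on
    \<open>B\<close> with the sup metric, and \<open>e\<close> below is the Kuratowski isometry. The
    elements of \<open>F\<close> are extensional, whence the restrictions to
    \<open>B\<close>.\<close>
  define F :: "('p \<Rightarrow> real) set" where "F = Met_TC.fspace B"
  define D :: "('p \<Rightarrow> real) \<Rightarrow> ('p \<Rightarrow> real) \<Rightarrow> real" where "D = Met_TC.fdist B"
  interpret F: Metric_space F D
    unfolding F_def D_def by (rule Met_TC.Metric_space_funspace)
  have inF: "restrict f B \<in> F" if "\<And>p. p \<in> B \<Longrightarrow> 0 \<le> f p \<and> f p \<le> 1" for f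
    unfolding F_def Met_TC.fspace_def using that
    by (auto simp: bounded_iff intro!: exI [of _ 1])
  have D_eq: "D f f' = (SUP p\<in>B. \<bar>f p - f' p\<bar>)" if "f \<in> F" "f' \<in> F" for f f'
    using that \<open>B \<noteq> {}\<close> by (simp add: D_def F_def Met_TC.fdist_def dist_real_def)
  have D_le: "D f f' \<le> c" if "f \<in> F" "f' \<in> F" "\<And>p. p \<in> B \<Longrightarrow> \<bar>f p - f' p\<bar> \<le> c" for f f' c
    using that \<open>B \<noteq> {}\<close> by (simp add: D_eq cSUP_least)
  have D_ge: "\<bar>f p - f' p\<bar> \<le> D f f'" if "f \<in> F" "f' \<in> F" "p \<in> B" for f f' p
    unfolding D_eq [OF that(1,2)] using Met_TC.bdd_above_dist [of f B f'] that \<open>B \<noteq> {}\<close>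
    by (intro cSUP_upper) (auto simp: F_def dist_real_def)
  define e where "e p = restrict (d p) B" for p
  have eF: "e p \<in> F" for p
    unfolding e_def by (intro inF) (simp add: d1)
  have iso: "D (e p) (e p') = d p p'" if p: "p \<in> B" "p' \<in> B" for p p'
  proof (rule antisym)
    show "D (e p) (e p') \<le> d p p'"
      using p B.triangle B.commute by (intro D_le eF) (simp add: e_def, smt (verit))
    show "d p p' \<le> D (e p) (e p')"
      using D_ge [OF eF eF, of p' p p'] p by (simp add: e_def)
  qed
  have "Metric_space12 B d F D"
    by (simp add: B F.Metric_space_axioms Metric_space12.intro)
  then have emb_e: "embedding_map P F.mtopology e"
    unfolding P_eq using iso eF by (intro Metric_space12.isometry_imp_embedding_map) auto
  define W where "W = prod_topology F.mtopology euclideanreal"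
  define Y where "Y = subtopology W {y. snd y = 0 \<longrightarrow> fst y \<in> e ` B}"
  define E where "E = (\<lambda>p. (e p, 0::real))"
  have "metrizable_space W"
    unfolding W_def by (simp add: metrizable_space_prod_topology F.metrizable_space_mtopology metrizable_space_euclidean)
  then have Y: "metrizable_space Y"
    unfolding Y_def by (rule metrizable_space_subtopology)
  have "embedding_map F.mtopology W (\<lambda>z. (z, 0))"
    unfolding W_def by (simp add: embedding_map_graph)
  then have "embedding_map P W ((\<lambda>z. (z, 0)) \<circ> e)"
    by (rule embedding_map_compose [OF emb_e])
  then have emb: "embedding_map P Y E"
    unfolding Y_def by (auto simp: embedding_map_in_subtopology E_def comp_def topP)
  have "continuous_map Y euclideanreal snd"
    unfolding Y_def W_def by (intro continuous_map_from_subtopology continuous_map_snd)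
  then have "closedin Y {y \<in> topspace Y. snd y \<in> {0}}"
    by (rule closedin_continuous_map_preimage) auto
  moreover have "{y \<in> topspace Y. snd y \<in> {0}} = E ` topspace P"
    using eF by (auto simp: Y_def W_def E_def topP image_iff)
  ultimately have cloE: "closedin Y (E ` topspace P)"
    by simp
  obtain \<iota> :: "('p \<Rightarrow> real) \<times> real \<Rightarrow> ('p \<Rightarrow> real)" where "inj \<iota>"
    by (rule inj_fun_real_prod)
  then have "inj_on \<iota> (topspace Y)"
    using inj_on_subset subset_UNIV by blast
  then obtain V \<pi> where V: "openin Y V" "E ` topspace P \<subseteq> V" "continuous_map (subtopology Y V) P \<pi>"
      "\<And>p. p \<in> topspace P \<Longrightarrow> \<pi> (E p) = p"
    by (rule ANR_space_neighbourhood_retraction [OF ANR Y _ emb cloE]) (rule that)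
  \<comment> \<open>\<open>q x\<close> takes the place of \<open>d (g x)\<close> in the Kuratowski
    embedding, so \<open>\<Gamma>\<close> extends \<open>E \<circ> g\<close> to all of
    \<open>X\<close>. The left inverse \<open>\<pi>\<close> of \<open>E\<close> is then applied
    where \<open>\<Gamma>\<close> lands in \<open>V\<close>.\<close>
  define \<Gamma> where "\<Gamma> x = (restrict (q x) B, r x)" for x
  have qF: "restrict (q x) B \<in> F" if "x \<in> A" for x
    using q0 q1 that by (intro inF) auto
  have \<Gamma>L: "\<Gamma> x = E (g x)" if "x \<in> L" for x
    using that qL r0 [of x] LA by (auto simp: \<Gamma>_def E_def e_def intro: restrict_ext)
  have "continuous_map A.mtopology F.mtopology (\<lambda>x. restrict (q x) B)"
    unfolding A.metric_continuous_map [OF F.Metric_space_axioms]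
  proof (intro conjI ballI allI impI)
    show "(\<lambda>x. restrict (q x) B) ` A \<subseteq> F"
      using qF by blast
    fix a and \<epsilon> :: real
    assume a: "a \<in> A" "0 < \<epsilon>"
    then obtain \<delta> where \<delta>: "\<delta> > 0" "\<And>x p. x \<in> A \<Longrightarrow> \<rho> a x < \<delta> \<Longrightarrow> p \<in> B \<Longrightarrow> \<bar>q a p - q x p\<bar> \<le> \<epsilon> / 2"
      using qc [of a "\<epsilon> / 2"] by auto
    have "D (restrict (q a) B) (restrict (q x) B) \<le> \<epsilon> / 2" if "x \<in> A" "\<rho> a x < \<delta>" for x
      using \<delta>(2) that a by (intro D_le qF) auto
    then have "D (restrict (q a) B) (restrict (q x) B) < \<epsilon>" if "x \<in> A" "\<rho> a x < \<delta>" for x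
      using that a(2) by fastforce
    then show "\<exists>\<delta>>0. \<forall>x. x \<in> A \<and> \<rho> a x < \<delta> \<longrightarrow> D (restrict (q a) B) (restrict (q x) B) < \<epsilon>"
      using \<delta>(1) by blast
  qed
  then have "continuous_map X W \<Gamma>"
    unfolding W_def \<Gamma>_def X_eq using rc by (intro continuous_map_pairedI)
  moreover have "\<Gamma> x \<in> {y. snd y = 0 \<longrightarrow> fst y \<in> e ` B}" if "x \<in> A" for x
    using \<Gamma>L [of x] r0 [OF that] gB by (auto simp: \<Gamma>_def E_def)
  ultimately have \<Gamma>: "continuous_map X Y \<Gamma>"
    unfolding Y_def by (auto simp: continuous_map_in_subtopology topX)
  show thesis
  proof (rule that [of "{x \<in> topspace X. \<Gamma> x \<in> V}" "\<pi> \<circ> \<Gamma>"])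
    show "openin X {x \<in> topspace X. \<Gamma> x \<in> V}"
      using \<Gamma> V(1) by (rule openin_continuous_map_preimage)
    show "L \<subseteq> {x \<in> topspace X. \<Gamma> x \<in> V}"
      using \<Gamma>L gB V(2) LA by (auto simp: topX topP)
    show "continuous_map (subtopology X {x \<in> topspace X. \<Gamma> x \<in> V}) P (\<pi> \<circ> \<Gamma>)"
      by (rule continuous_map_compose [OF _ V(3)])
        (auto simp: continuous_map_in_subtopology intro: continuous_map_from_subtopology \<Gamma>)
    show "(\<pi> \<circ> \<Gamma>) x = g x" if "x \<in> L" for x
      using that V(4) gB by (simp add: \<Gamma>L topP)
  qed
qed

text \<open>A homeomorphism onto \<open>A\<close>, extended as a map into \<open>M\<close>, sends a
  smaller neighbourhood into the open set \<open>A\<close>; followed by the inverse it is the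
  retraction. The basin, being open in \<open>M\<close>, is an ANR for this reason.\<close>

lemma ANR_space_openin:
  fixes M :: "'a topology"
  assumes ANR: "ANR_space M" and A: "openin M A"
  shows "ANR_space (subtopology M A)"
  unfolding ANR_space_def
proof (intro conjI allI impI)
  show "metrizable_space (subtopology M A)"
    using ANR by (simp add: ANR_space_def metrizable_space_subtopology)
  fix Y :: "('a \<Rightarrow> real) topology" and S
  assume *: "metrizable_space Y \<and> closedin Y S \<and> subtopology Y S homeomorphic_space subtopology M A"
  then obtain \<phi> \<psi> where h: "homeomorphic_maps (subtopology Y S) (subtopology M A) \<phi> \<psi>"
    by (auto simp: homeomorphic_space_def)
  then have "continuous_map (subtopology Y S) M \<phi>"
    by (auto simp: homeomorphic_maps_def continuous_map_in_subtopology)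
  then obtain U g where U: "openin Y U" "S \<subseteq> U" "continuous_map (subtopology Y U) M g"
      "\<And>x. x \<in> S \<Longrightarrow> g x = \<phi> x"
    using ANR_space_extension [OF ANR, of Y S \<phi>] * by blast
  define V where "V = {y \<in> topspace (subtopology Y U). g y \<in> A}"
  have "openin (subtopology Y U) V"
    unfolding V_def using U(3) A by (rule openin_continuous_map_preimage)
  then have oV: "openin Y V"
    using U(1) openin_trans_full by blast
  have SY: "S \<subseteq> topspace Y"
    using * closedin_subset by blast
  have \<phi>A: "\<phi> x \<in> A" if "x \<in> S" for x
    using h that SY by (auto simp: homeomorphic_maps_def continuous_map_in_subtopology)
  have SV: "S \<subseteq> V"
    using U(2,4) \<phi>A SY by (auto simp: V_def)
  have "continuous_map (subtopology Y V) M g"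
    by (rule continuous_map_from_subtopology_mono [OF U(3)]) (auto simp: V_def)
  then have "continuous_map (subtopology Y V) (subtopology M A) g"
    by (auto simp: continuous_map_in_subtopology V_def)
  then have "continuous_map (subtopology Y V) (subtopology Y S) (\<psi> \<circ> g)"
    using h by (auto simp: homeomorphic_maps_def intro: continuous_map_compose)
  moreover have "(\<psi> \<circ> g) x = x" if "x \<in> S" for x
    using h that U(4) SY by (auto simp: homeomorphic_maps_def)
  ultimately have "S retract_of_space subtopology Y V"
    unfolding retract_of_space_def using SV SY
    by (auto simp: subtopology_subtopology Int_absorb1)
  then show "\<exists>U. openin Y U \<and> S \<subseteq> U \<and> S retract_of_space subtopology Y U"
    using oV SV by blast
qed

section \<open>Homotopy extension\<close>

abbreviation I01 :: "real topology" where
  "I01 \<equiv> top_of_set {0..1}"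

lemma continuous_map_compose': "continuous_map X Y f \<Longrightarrow> continuous_map Y Z g \<Longrightarrow> continuous_map X Z (\<lambda>x. g (f x))"
  using continuous_map_compose [of X Y f Z g] by (simp add: comp_def)

lemma compact_space_I01: "compact_space I01"
  by (simp add: compact_space_subtopology)

lemma metrizable_space_prod_I01: "metrizable_space X \<Longrightarrow> metrizable_space (prod_topology I01 X)"
  by (simp add: metrizable_space_prod_topology metrizable_space_subtopology metrizable_space_euclidean)

lemma closedin_I01: "closed S \<Longrightarrow> S \<subseteq> {0..1} \<Longrightarrow> closedin I01 S"
  by (simp add: closedin_subset_topspace)

text \<open>By the tube lemma, an open set that contains all fibres over \<open>K\<close> contains
  the fibres over a neighbourhood of \<open>K\<close>. This is how neighbourhoods in a cylinder are
  replaced by neighbourhoods in its base.\<close>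

lemma openin_tube:
  assumes Z: "compact_space Z" and U: "openin (prod_topology Z X) U"
  shows "openin X {x \<in> topspace X. \<forall>z\<in>topspace Z. (z, x) \<in> U}"
proof (subst openin_subopen, intro ballI)
  fix x
  assume "x \<in> {x \<in> topspace X. \<forall>z\<in>topspace Z. (z, x) \<in> U}"
  then have "x \<in> topspace X" "topspace Z \<times> {x} \<subseteq> U"
    by auto
  then obtain V W where "openin X W" "topspace Z \<subseteq> V" "x \<in> W" "V \<times> W \<subseteq> U"
    using tube_lemma_left [OF U] Z unfolding compact_space_def by metis
  then show "\<exists>T. openin X T \<and> x \<in> T \<and> T \<subseteq> {x \<in> topspace X. \<forall>z\<in>topspace Z. (z, x) \<in> U}"
    using openin_subset by (intro exI [of _ W]) blast
qed

lemma continuous_map_closed_Un: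
  assumes "closedin X A" "closedin X B"
    and "continuous_map (subtopology X A) Y g" "continuous_map (subtopology X B) Y g"
  shows "continuous_map (subtopology X (A \<union> B)) Y g"
proof (rule pasting_lemma_closed [where I = UNIV and T = "\<lambda>i. if i then A else B" and f = "\<lambda>_. g"])
  show "continuous_map (subtopology (subtopology X (A \<union> B)) (if i then A else B)) Y g" for i
    using assms by (simp add: subtopology_subtopology Int_absorb1)
  show "closedin (subtopology X (A \<union> B)) (if i then A else B)" for i
    using assms by (auto intro: closedin_subset_topspace)
qed auto

lemma continuous_map_prod_closed_Un:
  assumes "closedin X A" "closedin X B"
    and "continuous_map (prod_topology Z (subtopology X A)) Y g"
    and "continuous_map (prod_topology Z (subtopology X B)) Y g"
  shows "continuous_map (prod_topology Z (subtopology X (A \<union> B))) Y g"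
proof -
  have "continuous_map (subtopology (prod_topology Z X) (topspace Z \<times> A \<union> topspace Z \<times> B)) Y g"
    using assms by (intro continuous_map_closed_Un) (auto simp: closedin_prod_Times_iff prod_topology_subtopology)
  then show ?thesis
    by (simp add: prod_topology_subtopology Sigma_Un_distrib2)
qed

lemma continuous_map_prod_subtopology_mono:
  assumes "continuous_map (prod_topology I01 (subtopology X V)) Y g" "W \<subseteq> V"
  shows "continuous_map (prod_topology I01 (subtopology X W)) Y g"
  using assms unfolding prod_topology_subtopology
  by (auto intro: continuous_map_from_subtopology_mono)

section \<open>Extension of homotopies into an ANR\<close>

lemma ANR_space_extension_tube:
  assumes ANR: "ANR_space P" and "metrizable_space X" "metrizable_space Z" and Z: "compact_space Z"
    and C: "closedin (prod_topology Z X) C" and K: "K \<subseteq> topspace X" "topspace Z \<times> K \<subseteq> C"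
    and g: "continuous_map (subtopology (prod_topology Z X) C) P g"
  obtains W g' where "openin X W" "K \<subseteq> W" "continuous_map (prod_topology Z (subtopology X W)) P g'"
    "\<And>z x. (z, x) \<in> C \<Longrightarrow> x \<in> W \<Longrightarrow> g' (z, x) = g (z, x)"
proof -
  have "metrizable_space (prod_topology Z X)"
    using assms by (simp add: metrizable_space_prod_topology)
  then obtain U g' where U: "openin (prod_topology Z X) U" "C \<subseteq> U"
      "continuous_map (subtopology (prod_topology Z X) U) P g'" "\<And>x. x \<in> C \<Longrightarrow> g' x = g x"
    by (rule ANR_space_extension [OF ANR _ C g]) (rule that)
  show thesis
  proof (rule that)
    \<comment> \<open>The points whose whole fibre lies in \<open>U\<close> form the tube; it
      contains \<open>K\<close> because the fibres over \<open>K\<close> lie in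
      \<open>C\<close>.\<close>
    show "openin X {x \<in> topspace X. \<forall>z\<in>topspace Z. (z, x) \<in> U}"
      by (rule openin_tube [OF Z U(1)])
    show "K \<subseteq> {x \<in> topspace X. \<forall>z\<in>topspace Z. (z, x) \<in> U}"
      using K U(2) by blast
    show "continuous_map (prod_topology Z (subtopology X {x \<in> topspace X. \<forall>z\<in>topspace Z. (z, x) \<in> U})) P g'"
      unfolding prod_topology_subtopology
      by (rule continuous_map_from_subtopology_mono [OF U(3)]) auto
  qed (use U(4) in auto)
qed

text \<open>Borsuk's argument: extend the map from the bottom of the cylinder and the part over
  \<open>C\<close> to a neighbourhood of both, then slow down time by a Urysohn function so that the
  track of every point stays in that neighbourhood.\<close>

lemma homotopy_extension_property:
  assumes ANR: "ANR_space P" and X: "metrizable_space X" and C: "closedin X C"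
    and f: "continuous_map X P f" and h: "continuous_map (prod_topology I01 (subtopology X C)) P h"
    and h0: "\<And>x. x \<in> C \<Longrightarrow> h (0, x) = f x"
  obtains H where "continuous_map (prod_topology I01 X) P H" "\<And>x. x \<in> topspace X \<Longrightarrow> H (0, x) = f x"
    "\<And>t x. t \<in> {0..1} \<Longrightarrow> x \<in> C \<Longrightarrow> H (t, x) = h (t, x)"
proof -
  define D where "D = {0} \<times> topspace X \<union> {0..1::real} \<times> C"
  define g where "g z = (if snd z \<in> C then h z else f (snd z))" for z :: "real \<times> 'b"
  have D: "closedin (prod_topology I01 X) ({0} \<times> topspace X)" "closedin (prod_topology I01 X) ({0..1} \<times> C)"
    using C by (auto simp: closedin_prod_Times_iff closedin_subtopology_alt intro!: closedin_subset_topspace)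
  have "continuous_map (subtopology (prod_topology I01 X) D) P g"
    unfolding D_def
  proof (rule continuous_map_closed_Un [OF D])
    show "continuous_map (subtopology (prod_topology I01 X) ({0} \<times> topspace X)) P g"
    proof (rule continuous_map_eq)
      show "continuous_map (subtopology (prod_topology I01 X) ({0} \<times> topspace X)) P (f \<circ> snd)"
        by (intro continuous_map_from_subtopology continuous_map_compose [OF continuous_map_snd f])
    qed (auto simp: g_def h0)
    show "continuous_map (subtopology (prod_topology I01 X) ({0..1} \<times> C)) P g"
      by (rule continuous_map_eq [of _ _ h]) (use h in \<open>auto simp: g_def prod_topology_subtopology\<close>)
  qed
  moreover have "metrizable_space (prod_topology I01 X)"
    using X by (simp add: metrizable_space_prod_topology metrizable_space_subtopology metrizable_space_euclidean)
  moreover have "closedin (prod_topology I01 X) D"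
    unfolding D_def using D by (rule closedin_Un)
  ultimately obtain U g' where U: "openin (prod_topology I01 X) U" "D \<subseteq> U"
      "continuous_map (subtopology (prod_topology I01 X) U) P g'" "\<And>z. z \<in> D \<Longrightarrow> g' z = g z"
    using ANR_space_extension [OF ANR] by metis
  define W where "W = {x \<in> topspace X. \<forall>t\<in>topspace I01. (t, x) \<in> U}"
  have W: "openin X W"
    unfolding W_def using U(1) by (intro openin_tube) (simp add: compact_space_subtopology)
  have CW: "C \<subseteq> W"
    using subset_trans [OF _ U(2)] closedin_subset [OF C] U(2) by (auto simp: W_def D_def)
  have dis: "disjnt (topspace X - W) C"
    using CW by (auto simp: disjnt_iff)
  \<comment> \<open>\<open>u\<close> is 1 on \<open>C\<close>, where time must run at full speed,
    and 0 off \<open>W\<close>, where the vertical segment may leave \<open>U\<close>.\<close>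
  obtain u where u: "continuous_map X I01 u" "u ` (topspace X - W) \<subseteq> {0}" "u ` C \<subseteq> {1}"
    by (rule Urysohn_lemma [of X "topspace X - W" C 0 1]) (use X C W dis in \<open>auto intro: metrizable_imp_normal_space\<close>)
  have u01: "u x \<in> {0..1}" if "x \<in> topspace X" for x
    using u(1) that by (auto simp: continuous_map_in_subtopology)
  define s where "s z = (fst z * u (snd z), snd z)" for z :: "real \<times> 'b"
  have sU: "s z \<in> U" if "z \<in> topspace (prod_topology I01 X)" for z
  proof (cases "snd z \<in> W")
    case True
    then show ?thesis
      using that u01 [of "snd z"] by (auto simp: s_def W_def mult_le_one)
  next
    case False
    then have "s z \<in> D"
      using that u(2) by (auto simp: s_def D_def image_subset_iff)
    then show ?thesis
      using U(2) by blast
  qed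
  have "continuous_map (prod_topology I01 X) euclideanreal (\<lambda>z. fst z * u (snd z))"
    using u(1) by (intro continuous_map_real_mult continuous_map_into_fulltopology [OF continuous_map_fst]
        continuous_map_into_fulltopology [OF continuous_map_compose [OF continuous_map_snd u(1), unfolded comp_def]])
  then have "continuous_map (prod_topology I01 X) (prod_topology I01 X) s"
    unfolding s_def using u01 
    by (intro continuous_map_pairedI continuous_map_snd) (auto simp: continuous_map_in_subtopology mult_le_one)
  then have s: "continuous_map (prod_topology I01 X) (subtopology (prod_topology I01 X) U) s"
    using sU by (auto simp: continuous_map_in_subtopology)
  show thesis
  proof (rule that)
    show "continuous_map (prod_topology I01 X) P (g' \<circ> s)"
      by (rule continuous_map_compose [OF s U(3)])
    show "(g' \<circ> s) (0, x) = f x" if "x \<in> topspace X" for x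
      using that U(4) [of "(0, x)"] h0 by (auto simp: s_def D_def g_def)
    show "(g' \<circ> s) (t, x) = h (t, x)" if "t \<in> {0..1}" "x \<in> C" for t x
      using that U(4) [of "(t, x)"] u(3) by (auto simp: s_def D_def g_def image_subset_iff)
  qed
qed

text \<open>Gluing the homotopy over \<open>K\<close> to the two given maps at the ends yields a map
  on a closed set that contains all fibres over \<open>K\<close>; extend it and shrink to a tube.
  The ends are thus exactly \<open>e0\<close> and \<open>e1\<close> near \<open>K\<close>, not
  merely homotopic to them.\<close>

lemma nearby_homotopy:
  assumes ANR: "ANR_space P" and X: "metrizable_space X" and K: "closedin X K"
    and e0: "continuous_map X P e0" and e1: "continuous_map X P e1"
    and k: "continuous_map (prod_topology I01 (subtopology X K)) P k"
      "\<And>x. x \<in> K \<Longrightarrow> k (0, x) = e0 x" "\<And>x. x \<in> K \<Longrightarrow> k (1, x) = e1 x"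
  obtains W g where "openin X W" "K \<subseteq> W" "continuous_map (prod_topology I01 (subtopology X W)) P g"
    "\<And>x. x \<in> W \<Longrightarrow> g (0, x) = e0 x" "\<And>x. x \<in> W \<Longrightarrow> g (1, x) = e1 x"
    "\<And>t x. t \<in> {0..1} \<Longrightarrow> x \<in> K \<Longrightarrow> g (t, x) = k (t, x)"
proof -
  define g where "g z = (if snd z \<in> K then k z else if fst z = 0 then e0 (snd z) else e1 (snd z))" for z :: "real \<times> 'b"
  let ?Z = "prod_topology I01 X"
  define C where "C = ({0} \<times> topspace X \<union> {1} \<times> topspace X) \<union> {0..1::real} \<times> K"
  have c0: "closedin ?Z ({0} \<times> topspace X)" and c1: "closedin ?Z ({1} \<times> topspace X)"
    and cK: "closedin ?Z ({0..1} \<times> K)"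
    using K by (simp_all add: closedin_prod_Times_iff closedin_I01)
  have g0: "continuous_map (subtopology ?Z ({0} \<times> topspace X)) P g"
    by (rule continuous_map_eq [of _ _ "\<lambda>z. e0 (snd z)"])
      (auto simp: g_def k intro!: continuous_map_from_subtopology continuous_map_compose' [OF continuous_map_snd e0])
  have g1: "continuous_map (subtopology ?Z ({1} \<times> topspace X)) P g"
    by (rule continuous_map_eq [of _ _ "\<lambda>z. e1 (snd z)"])
      (auto simp: g_def k intro!: continuous_map_from_subtopology continuous_map_compose' [OF continuous_map_snd e1])
  have gK: "continuous_map (subtopology ?Z ({0..1} \<times> K)) P g"
    by (rule continuous_map_eq [of _ _ k]) (use k(1) in \<open>auto simp: g_def prod_topology_subtopology\<close>)
  have "closedin ?Z C"
    unfolding C_def using c0 c1 cK by blast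
  moreover have "continuous_map (subtopology ?Z C) P g"
    unfolding C_def by (intro continuous_map_closed_Un closedin_Un c0 c1 cK g0 g1 gK)
  moreover have "topspace I01 \<times> K \<subseteq> C"
    by (auto simp: C_def)
  moreover have "metrizable_space I01"
    by (simp add: metrizable_space_subtopology metrizable_space_euclidean)
  ultimately obtain W g' where W: "openin X W" "K \<subseteq> W" "continuous_map (prod_topology I01 (subtopology X W)) P g'"
    and g': "\<And>t x. (t, x) \<in> C \<Longrightarrow> x \<in> W \<Longrightarrow> g' (t, x) = g (t, x)"
    using ANR_space_extension_tube [OF ANR X _ compact_space_I01 _ closedin_subset [OF K]] by metis
  show thesis
  proof (rule that [OF W])
    have WX: "W \<subseteq> topspace X"
      using W(1) by (rule openin_subset)
    show "g' (0, x) = e0 x" "g' (1, x) = e1 x" if "x \<in> W" for x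
      using that WX g' [of 0 x] g' [of 1 x] k(2,3) by (auto simp: C_def g_def)
    show "g' (t, x) = k (t, x)" if "t \<in> {0..1}" "x \<in> K" for t x
      using that g' [of t x] W(2) by (auto simp: C_def g_def)
  qed
qed

text \<open>
  Contract the path along the sides \<open>h\<^sub>s \<circ> h\<^sub>0\<close> and \<open>h\<^sub>0 \<circ> h\<^sub>s\<close> of the square \<open>h\<^sub>u \<circ> h\<^sub>v\<close>: for \<open>t = 1/2\<close> one has
  \<open>v = 0\<close> or \<open>u = v\<close>, so that \<open>h\<^sub>u\<close> and \<open>h\<^sub>v\<close> commute and the two halves match.
\<close>

lemma commuting_homotopy:
  fixes h :: "real \<times> 'a \<Rightarrow> 'a"
  assumes h: "continuous_map (prod_topology I01 X) X h" and h0: "\<And>x. x \<in> topspace X \<Longrightarrow> h (0, x) = x"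
  obtains Q where "continuous_map (prod_topology I01 (prod_topology I01 X)) X Q"
    "\<And>s x. s \<in> {0..1} \<Longrightarrow> x \<in> topspace X \<Longrightarrow> Q (0, s, x) = h (s, h (1, x))"
    "\<And>s x. s \<in> {0..1} \<Longrightarrow> x \<in> topspace X \<Longrightarrow> Q (1, s, x) = h (1, h (s, x))"
    "\<And>t x. t \<in> {0..1} \<Longrightarrow> x \<in> topspace X \<Longrightarrow> Q (t, 0, x) = h (1, x)"
    "\<And>t x. t \<in> {0..1} \<Longrightarrow> x \<in> topspace X \<Longrightarrow> Q (t, 1, x) = h (1, h (1, x))"
proof -
  define Z where "Z = prod_topology I01 (prod_topology I01 X)"
  \<comment> \<open>A tent with values 0, 1, 0 at \<open>t = 0, 1/2, 1\<close>. The pair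
    \<open>(u, v)\<close> moves linearly from \<open>(1, s)\<close> to the path that runs along
    \<open>v = 0\<close> from \<open>(1, 0)\<close> to \<open>(0, 0)\<close> and then along the
    diagonal to \<open>(1, 1)\<close>, and back.\<close>
  define \<tau> where "\<tau> t = 1 - \<bar>1 - 2 * t\<bar>" for t :: real
  define u where "u z = (1 - \<tau> (fst z)) + \<tau> (fst z) * \<bar>2 * fst (snd z) - 1\<bar>" for z :: "real \<times> real \<times> 'a"
  define v where "v z = (1 - \<tau> (fst z)) * fst (snd z) + \<tau> (fst z) * max 0 (2 * fst (snd z) - 1)"
    for z :: "real \<times> real \<times> 'a"
  have p: "continuous_map Z euclideanreal fst" "continuous_map Z euclideanreal (\<lambda>z. fst (snd z))"
    "continuous_map Z X (\<lambda>z. snd (snd z))"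
    unfolding Z_def
    by (auto intro: continuous_map_into_fulltopology [OF continuous_map_fst] continuous_map_compose' continuous_map_snd)
  have conv: "(1 - c) * a + c * b \<in> {0..1}" if "c \<in> {0..1}" "a \<in> {0..1}" "b \<in> {0..1}" for a b c :: real
    using convexD_alt [of "{0..1::real}" a b c] that by simp
  have \<tau>01: "\<tau> t \<in> {0..1}" if "t \<in> {0..1}" for t
    using that by (auto simp: \<tau>_def)
  have u01: "u z \<in> {0..1}" and v01: "v z \<in> {0..1}" if "z \<in> topspace Z" for z
    using that conv [OF \<tau>01 [of "fst z"], of 1 "\<bar>2 * fst (snd z) - 1\<bar>"]
      conv [OF \<tau>01 [of "fst z"], of "fst (snd z)" "max 0 (2 * fst (snd z) - 1)"]
    by (auto simp: Z_def u_def v_def)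
  have "continuous_map Z euclideanreal u" "continuous_map Z euclideanreal v"
    unfolding u_def v_def \<tau>_def
    by (intro continuous_map_add continuous_map_diff continuous_map_real_mult continuous_map_real_abs
        continuous_map_real_max p; simp)+
  then have u: "continuous_map Z I01 u" and v: "continuous_map Z I01 v"
    using u01 v01 by (auto simp: continuous_map_in_subtopology)
  have hc: "continuous_map Z X (\<lambda>z. h (a z, k z))" if "continuous_map Z I01 a" "continuous_map Z X k" for a k
    using continuous_map_compose' [OF continuous_map_pairedI [OF that] h] .
  define Q where "Q z = (if fst z \<le> 1/2 then h (v z, h (u z, snd (snd z))) else h (u z, h (v z, snd (snd z))))" for z
  show thesis
  proof (rule that)
    have "continuous_map Z X Q"
      unfolding Q_def
    proof (rule continuous_map_cases_le)
      fix z
      assume "z \<in> topspace Z" and "fst z = 1/2"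
      then obtain s x where z: "z = (1/2, s, x)" "s \<in> {0..1}" "x \<in> topspace X"
        by (auto simp: Z_def)
      have uv: "u z = \<bar>2 * s - 1\<bar>" "v z = max 0 (2 * s - 1)"
        by (auto simp: u_def v_def \<tau>_def z(1))
      show "h (v z, h (u z, snd (snd z))) = h (u z, h (v z, snd (snd z)))"
      proof (cases "s \<le> 1/2")
        case True
        then have "v z = 0"
          by (simp add: uv)
        moreover have "h (u z, x) \<in> topspace X"
          using h u01 [OF \<open>z \<in> topspace Z\<close>] z(3) by (auto simp: continuous_map_def)
        ultimately show ?thesis
          using z by (simp add: h0)
      qed (simp add: uv)
    qed (auto intro!: continuous_map_from_subtopology hc u v p)
    then show "continuous_map (prod_topology I01 (prod_topology I01 X)) X Q"
      by (simp add: Z_def)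
    fix x
    assume x: "x \<in> topspace X"
    have hx: "h (t, x) \<in> topspace X" if "t \<in> {0..1}" for t
      using h x that by (auto simp: continuous_map_def)
    show "Q (0, s, x) = h (s, h (1, x))" "Q (1, s, x) = h (1, h (s, x))" for s
      by (auto simp: Q_def u_def v_def \<tau>_def)
    show "Q (t, 0, x) = h (1, x)" "Q (t, 1, x) = h (1, h (1, x))" for t
      using x hx [of 1] by (auto simp: Q_def u_def v_def h0)
  qed
qed

section \<open>The telescope principle\<close>

text \<open>Since \<open>\<phi>\<close> maps \<open>S'\<close> into \<open>S\<close>, the equation
  determines time 0 on \<open>S'\<close> from \<open>J\<close> alone. Homotopy extension from
  \<open>S \<union> (B \<inter> S')\<close> supplies the rest, and the equation survives because the
  new homotopy equals \<open>J\<close> on \<open>S\<close>.\<close>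

lemma telescope_step:
  assumes ANR: "ANR_space P" and Y: "metrizable_space Y" and \<phi>: "continuous_map Y Y \<phi>"
    and S: "closedin Y S" "closedin Y S'" "S \<subseteq> S'" "\<phi> ` S' \<subseteq> S"
    and B: "closedin Y B" "\<phi> ` B \<subseteq> B" and \<psi>: "continuous_map P P \<psi>"
    and b: "continuous_map (prod_topology I01 (subtopology Y B)) P b"
      "\<And>y. y \<in> B \<Longrightarrow> b (0, y) = \<psi> (b (1, \<phi> y))"
    and J: "continuous_map (prod_topology I01 (subtopology Y S)) P J"
      "\<And>y. y \<in> S \<Longrightarrow> J (0, y) = \<psi> (J (1, \<phi> y))"
      "\<And>t y. t \<in> {0..1} \<Longrightarrow> y \<in> S \<inter> B \<Longrightarrow> J (t, y) = b (t, y)"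
  obtains J' where "continuous_map (prod_topology I01 (subtopology Y S')) P J'"
    "\<And>y. y \<in> S' \<Longrightarrow> J' (0, y) = \<psi> (J' (1, \<phi> y))"
    "\<And>t y. t \<in> {0..1} \<Longrightarrow> y \<in> S' \<inter> B \<Longrightarrow> J' (t, y) = b (t, y)"
    "\<And>t y. t \<in> {0..1} \<Longrightarrow> y \<in> S \<Longrightarrow> J' (t, y) = J (t, y)"
proof -
  define X where "X = subtopology Y S'"
  define C where "C = S \<union> (B \<inter> S')"
  define h where "h z = (if snd z \<in> S then J z else b z)" for z :: "real \<times> 'b"
  define f where "f y = \<psi> (J (1, \<phi> y))" for y
  have S'Y: "S' \<subseteq> topspace Y"
    using S(2) closedin_subset by blast
  have clo: "closedin Y (B \<inter> S')"
    using B(1) S(2) by blast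
  have X: "metrizable_space X"
    unfolding X_def using Y by (rule metrizable_space_subtopology)
  have "C \<subseteq> S'"
    using S(3) by (auto simp: C_def)
  then have sub: "subtopology X C = subtopology Y C"
    by (simp add: X_def subtopology_subtopology Int_absorb1)
  have C: "closedin X C"
    unfolding X_def using \<open>C \<subseteq> S'\<close> clo S(1) by (auto simp: C_def intro!: closedin_subset_topspace)
  have \<phi>S: "continuous_map X (subtopology Y S) \<phi>"
    unfolding X_def using \<phi> S(4) by (auto simp: continuous_map_in_subtopology intro: continuous_map_from_subtopology)
  have "continuous_map (subtopology Y S) (prod_topology I01 (subtopology Y S)) (\<lambda>y. (1, y))"
    by (auto intro!: continuous_map_pairedI)
  then have "continuous_map X P (\<psi> \<circ> (J \<circ> ((\<lambda>y. (1, y)) \<circ> \<phi>)))"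
    using \<psi> J(1) \<phi>S by (meson continuous_map_compose)
  then have f: "continuous_map X P f"
    by (simp add: f_def [abs_def] comp_def)
  have "continuous_map (prod_topology I01 (subtopology Y C)) P h"
    unfolding C_def
  proof (rule continuous_map_prod_closed_Un [OF S(1) clo])
    show "continuous_map (prod_topology I01 (subtopology Y S)) P h"
      by (rule continuous_map_eq [OF J(1)]) (auto simp: h_def)
    have "continuous_map (prod_topology I01 (subtopology Y (B \<inter> S'))) P b"
      using b(1) unfolding prod_topology_subtopology
      by (rule continuous_map_from_subtopology_mono) auto
    then show "continuous_map (prod_topology I01 (subtopology Y (B \<inter> S'))) P h"
      by (rule continuous_map_eq) (auto simp: h_def J(3))
  qed
  then have h: "continuous_map (prod_topology I01 (subtopology X C)) P h"
    by (simp add: sub)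
  have h0: "h (0, y) = f y" if "y \<in> C" for y
  proof (cases "y \<in> S")
    case True
    then show ?thesis
      by (simp add: h_def f_def J(2))
  next
    case False
    \<comment> \<open>Here \<open>\<phi> y\<close> lies in both \<open>S\<close> and
      \<open>B\<close>, where \<open>J\<close> and \<open>b\<close> agree, so the equation for
      \<open>b\<close> yields the required start.\<close>
    then have y: "y \<in> B" "\<phi> y \<in> S \<inter> B"
      using that B(2) S(4) by (auto simp: C_def)
    then show ?thesis
      using False J(3) [of 1 "\<phi> y"] by (simp add: h_def f_def b(2))
  qed
  obtain H where H: "continuous_map (prod_topology I01 X) P H"
      "\<And>y. y \<in> topspace X \<Longrightarrow> H (0, y) = f y" "\<And>t y. t \<in> {0..1} \<Longrightarrow> y \<in> C \<Longrightarrow> H (t, y) = h (t, y)"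
    using homotopy_extension_property [OF ANR X C f h h0] by blast
  have HS: "H (t, y) = J (t, y)" if "t \<in> {0..1}" "y \<in> S" for t y
    using H(3) that by (simp add: C_def h_def)
  show thesis
  proof (rule that)
    show "continuous_map (prod_topology I01 (subtopology Y S')) P H"
      using H(1) by (simp add: X_def)
    show "H (0, y) = \<psi> (H (1, \<phi> y))" if y: "y \<in> S'" for y
    proof -
      have "\<phi> y \<in> S" "y \<in> topspace X"
        using that S(4) S'Y by (auto simp: X_def)
      then show ?thesis
        using HS [of 1 "\<phi> y"] by (simp add: H(2) f_def)
    qed
    show "H (t, y) = b (t, y)" if "t \<in> {0..1}" "y \<in> S' \<inter> B" for t y
      using that H(3) [of t y] J(3) [of t y] by (auto simp: C_def h_def)
  qed (rule HS)
qed

text \<open>Iterate \<open>telescope_step\<close> over the preimages of \<open>T\<close> under the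
  powers of \<open>\<phi>\<close>, which increase and cover \<open>Y\<close> by
  \<open>absorb\<close>. The invariant set \<open>B\<close> carries a solution given in advance; it
  controls the ends when \<open>Y\<close> is itself a cylinder.\<close>

lemma telescope_extension:
  fixes Y :: "'y topology" and P :: "'p topology"
  assumes ANR: "ANR_space P" and Y: "metrizable_space Y" and \<phi>: "continuous_map Y Y \<phi>"
    and T: "closedin Y T" "openin Y T'" "T' \<subseteq> T" "\<phi> ` T \<subseteq> T'"
    and absorb: "\<And>y. y \<in> topspace Y \<Longrightarrow> \<exists>k. (\<phi> ^^ k) y \<in> T"
    and B: "closedin Y B" "\<phi> ` B \<subseteq> B" and \<psi>: "continuous_map P P \<psi>"
    and b: "continuous_map (prod_topology I01 (subtopology Y B)) P b"
      "\<And>y. y \<in> B \<Longrightarrow> b (0, y) = \<psi> (b (1, \<phi> y))"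
    and J0: "continuous_map (prod_topology I01 (subtopology Y T)) P J0"
      "\<And>y. y \<in> T \<Longrightarrow> J0 (0, y) = \<psi> (J0 (1, \<phi> y))"
      "\<And>t y. t \<in> {0..1} \<Longrightarrow> y \<in> T \<inter> B \<Longrightarrow> J0 (t, y) = b (t, y)"
  obtains J where "continuous_map (prod_topology I01 Y) P J"
    "\<And>y. y \<in> topspace Y \<Longrightarrow> J (0, y) = \<psi> (J (1, \<phi> y))"
    "\<And>t y. t \<in> {0..1} \<Longrightarrow> y \<in> B \<Longrightarrow> J (t, y) = b (t, y)"
    "\<And>t y. t \<in> {0..1} \<Longrightarrow> y \<in> T \<Longrightarrow> J (t, y) = J0 (t, y)"
proof -
  \<comment> \<open>The closed \<open>S k\<close> carry the homotopies. The open \<open>O' k\<close>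
    satisfy \<open>S k \<subseteq> O' (Suc k) \<subseteq> S (Suc k)\<close>, so continuity of the
    union can be checked on them.\<close>
  define S where "S k = {y \<in> topspace Y. (\<phi> ^^ k) y \<in> T}" for k
  define O' where "O' k = {y \<in> topspace Y. (\<phi> ^^ k) y \<in> T'}" for k
  have \<phi>n: "continuous_map Y Y (\<phi> ^^ k)" for k
    by (induction k) (auto intro: continuous_map_compose \<phi> simp: id_def simp del: o_apply comp_apply)
  have S: "closedin Y (S k)" and O': "openin Y (O' k)" for k
    unfolding S_def O'_def
    using closedin_continuous_map_preimage [OF \<phi>n T(1)] openin_continuous_map_preimage [OF \<phi>n T(2)] by auto
  have \<phi>Y: "\<phi> y \<in> topspace Y" if "y \<in> topspace Y" for y
    using \<phi> that by (auto simp: continuous_map_def)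
  have Ssub: "S k \<subseteq> S (Suc k)" and S\<phi>: "\<phi> ` S (Suc k) \<subseteq> S k" and SO: "S k \<subseteq> O' (Suc k)" and OS: "O' k \<subseteq> S k" for k
    using T(3,4) \<phi>Y by (auto simp: S_def O'_def simp flip: funpow_swap1)
  have S\<phi>': "\<phi> ` S k \<subseteq> S k" for k
    using S\<phi> [of k] Ssub [of k] by blast
  have S0: "S 0 = T"
    using closedin_subset [OF T(1)] by (auto simp: S_def)
  \<comment> \<open>The last clause fixes the first stage as \<open>J0\<close>, which dependent
    choice would otherwise leave open.\<close>
  define good where "good k J \<longleftrightarrow> continuous_map (prod_topology I01 (subtopology Y (S k))) P J
      \<and> (\<forall>y\<in>S k. J (0, y) = \<psi> (J (1, \<phi> y))) \<and> (\<forall>t\<in>{0..1}. \<forall>y\<in>S k \<inter> B. J (t, y) = b (t, y))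
      \<and> (k = 0 \<longrightarrow> J = J0)" for k J
  have "\<exists>J. good 0 J"
    using J0 by (auto simp: good_def S0)
  moreover have "\<exists>J'. good (Suc k) J' \<and> (\<forall>t\<in>{0..1}. \<forall>y\<in>S k. J' (t, y) = J (t, y))" if "good k J" for k J
  proof -
    have J: "continuous_map (prod_topology I01 (subtopology Y (S k))) P J"
      "\<And>y. y \<in> S k \<Longrightarrow> J (0, y) = \<psi> (J (1, \<phi> y))"
      "\<And>t y. t \<in> {0..1} \<Longrightarrow> y \<in> S k \<inter> B \<Longrightarrow> J (t, y) = b (t, y)"
      using that by (auto simp: good_def)
    show ?thesis
      by (rule telescope_step [OF ANR Y \<phi> S S Ssub S\<phi> B \<psi> b J]; (assumption | auto simp: good_def))
  qed
  ultimately obtain J where good: "\<And>k. good k (J k)"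
    and ext: "\<And>k t y. t \<in> {0..1} \<Longrightarrow> y \<in> S k \<Longrightarrow> J (Suc k) (t, y) = J k (t, y)"
    using dependent_nat_choice [of good "\<lambda>k J J'. \<forall>t\<in>{0..1}. \<forall>y\<in>S k. J' (t, y) = J (t, y)"] by metis
  have Smono: "S i \<subseteq> S j" if "i \<le> j" for i j
    using Ssub that by (rule lift_Suc_mono_le)
  have Jmono: "J j (t, y) = J i (t, y)" if "i \<le> j" "t \<in> {0..1}" "y \<in> S i" for i j t y
    using that
  proof (induction rule: dec_induct)
    case (step n)
    then have "y \<in> S n"
      using Smono by blast
    then show ?case
      using step ext by simp
  qed simp
  \<comment> \<open>For times in \<open>[0, 1]\<close> the stages agree wherever they are defined,
    so any index with \<open>snd z \<in> S k\<close> gives the same value as the least one.\<close>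
  define H where "H z = J (LEAST k. snd z \<in> S k) z" for z
  have HJ: "H (t, y) = J k (t, y)" if "t \<in> {0..1}" "y \<in> S k" for k t y
    using that Jmono [of "LEAST k. y \<in> S k" k t y] LeastI [of "\<lambda>k. y \<in> S k" k] by (simp add: H_def Least_le)
  have cover: "\<exists>k. y \<in> S k" if "y \<in> topspace Y" for y
    using absorb [OF that] that by (auto simp: S_def)
  show thesis
  proof (rule that)
    show "continuous_map (prod_topology I01 Y) P H"
    proof (rule pasting_lemma [where I = UNIV and T = "\<lambda>k. {0..1} \<times> O' k" and f = J])
      show "openin (prod_topology I01 Y) ({0..1} \<times> O' k)" for k
        using O' by (auto simp: openin_prod_Times_iff openin_topspace [of I01, simplified])
      have "{0..1} \<times> O' k \<subseteq> {0..1::real} \<times> S k" for k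
        using OS by blast
      then show "continuous_map (subtopology (prod_topology I01 Y) ({0..1} \<times> O' k)) P (J k)" for k
        using good [of k] unfolding good_def prod_topology_subtopology
        by (metis continuous_map_from_subtopology_mono topspace_euclidean_subtopology)
      show "J i z = J j z" if "z \<in> topspace (prod_topology I01 Y) \<inter> {0..1} \<times> O' i \<inter> {0..1} \<times> O' j" for i j z
        using that OS HJ by (cases z) (metis Int_iff SigmaD1 SigmaD2 subsetD)
      show "\<exists>k. k \<in> UNIV \<and> z \<in> {0..1} \<times> O' k \<and> H z = J k z" if z_in: "z \<in> topspace (prod_topology I01 Y)" for z
      proof -
        obtain t y where z: "z = (t, y)" "t \<in> {0..1}" "y \<in> topspace Y"
          using z_in by (cases z) auto
        obtain k where "y \<in> S k"
          using cover z(3) by blast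
        then have "y \<in> O' (Suc k)" "y \<in> S (Suc k)"
          using SO Ssub by blast+
        then show ?thesis
          using z HJ by blast
      qed
    qed
    show "H (0, y) = \<psi> (H (1, \<phi> y))" if y: "y \<in> topspace Y" for y
    proof -
      obtain k where "y \<in> S k"
        using cover y by blast
      moreover from this have "\<phi> y \<in> S k"
        using S\<phi>' by blast
      ultimately show ?thesis
        using good [of k] HJ [of 0 y k] HJ [of 1 "\<phi> y" k] unfolding good_def by simp
    qed
    show "H (t, y) = b (t, y)" if ty: "t \<in> {0..1}" "y \<in> B" for t y
    proof -
      obtain k where "y \<in> S k"
        using cover ty B(1) closedin_subset by blast
      then show ?thesis
        using good [of k] HJ [of _ _ k] ty unfolding good_def by simp
    qed
    show "H (t, y) = J0 (t, y)" if "t \<in> {0..1}" "y \<in> T" for t y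
      using HJ [of t y 0] good [of 0] that by (simp add: S0 good_def)
  qed
qed

section \<open>Shape equivalences from bijections on homotopy classes\<close>

definition homotopy_class :: "'x topology \<Rightarrow> 'p topology \<Rightarrow> ('x \<Rightarrow> 'p) \<Rightarrow> ('x \<Rightarrow> 'p) set" where
  "homotopy_class X P g = homotopy_rel X P `` {g}"

lemma mem_homotopy_class: "h \<in> homotopy_class X P g \<longleftrightarrow> homotopic_with (\<lambda>_. True) X P g h"
  by (simp add: homotopy_class_def homotopy_rel_def)

lemma homotopy_class_eq:
  assumes "continuous_map X P g"
  shows "homotopy_class X P g = homotopy_class X P h \<longleftrightarrow> homotopic_with (\<lambda>_. True) X P g h"
proof
  show "homotopy_class X P g = homotopy_class X P h \<Longrightarrow> homotopic_with (\<lambda>_. True) X P g h"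
    using assms by (metis homotopic_with_refl homotopic_with_sym mem_homotopy_class)
  show "homotopic_with (\<lambda>_. True) X P g h \<Longrightarrow> homotopy_class X P g = homotopy_class X P h"
    by (intro set_eqI) (metis mem_homotopy_class homotopic_with_trans homotopic_with_symD)
qed

lemma homotopy_classesE:
  assumes "c \<in> homotopy_classes X P"
  obtains g where "continuous_map X P g" "c = homotopy_class X P g"
  using assms by (auto simp: homotopy_classes_def quotient_def homotopy_class_def)

lemma homotopy_class_in: "continuous_map X P g \<Longrightarrow> homotopy_class X P g \<in> homotopy_classes X P"
  by (auto simp: homotopy_classes_def quotient_def homotopy_class_def)

lemma postcomp_homotopy_class:
  assumes "continuous_map X P g" "continuous_map P Q u"
  shows "postcomp_class X Q u (homotopy_class X P g) = homotopy_class X Q (u \<circ> g)"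
proof -
  have "homotopic_with (\<lambda>_. True) X Q (u \<circ> g) (u \<circ> h)" if "homotopic_with (\<lambda>_. True) X P g h" for h
    using that assms(2) by (rule homotopic_with_compose_continuous_map_left) simp
  then show ?thesis
    unfolding set_eq_iff mem_homotopy_class
    by (auto simp: postcomp_class_def homotopy_class_def homotopy_rel_def intro: homotopic_with_trans)
      (metis assms(1) homotopic_with_refl)
qed

lemma induced_shape_homotopy_class:
  assumes "continuous_map X Y i" "continuous_map Y P g"
  shows "induced_shape X i P (homotopy_class Y P g) = homotopy_class X P (g \<circ> i)"
proof -
  have "homotopic_with (\<lambda>_. True) X P (g \<circ> i) (h \<circ> i)" if "homotopic_with (\<lambda>_. True) Y P g h" for h
    using that assms(1) by (rule homotopic_with_compose_continuous_map_right) simp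
  then show ?thesis
    unfolding set_eq_iff mem_homotopy_class
    by (auto simp: induced_shape_def homotopy_class_def homotopy_rel_def intro: homotopic_with_trans)
      (metis assms(2) homotopic_with_refl)
qed

text \<open>A natural transformation with bijective components has a natural inverse, so bijectivity
  of precomposition with \<open>i\<close> on homotopy classes into each ANR is enough.\<close>

lemma shape_equivalence_if_bijective:
  fixes X :: "'x topology" and Y :: "'y topology"
  assumes i: "continuous_map X Y i"
    and surj: "\<And>(P :: 'p topology) g. ANR_space P \<Longrightarrow> continuous_map X P g \<Longrightarrow>
      \<exists>G. continuous_map Y P G \<and> homotopic_with (\<lambda>_. True) X P (G \<circ> i) g"
    and inj: "\<And>(P :: 'p topology) G G'. ANR_space P \<Longrightarrow> continuous_map Y P G \<Longrightarrow> continuous_map Y P G' \<Longrightarrow>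
      homotopic_with (\<lambda>_. True) X P (G \<circ> i) (G' \<circ> i) \<Longrightarrow> homotopic_with (\<lambda>_. True) Y P G G'"
  shows "shape_equivalence TYPE('p) X Y i"
proof -
  \<comment> \<open>\<open>SOME\<close> picks a map whose restriction lies in the given class: it
    exists by \<open>surj\<close>, and by \<open>inj\<close> its class does not depend on the
    choice.\<close>
  define \<sigma> :: "('y, 'x, 'p) class_transformation" where
    "\<sigma> = (\<lambda>P c. homotopy_class Y P (SOME G. continuous_map Y P G \<and> G \<circ> i \<in> c))"
  let ?\<tau> = "induced_shape X i :: ('x, 'y, 'p) class_transformation"
  have \<tau>: "?\<tau> P (homotopy_class Y P G) = homotopy_class X P (G \<circ> i)" if "continuous_map Y P G" for P G
    using i that by (rule induced_shape_homotopy_class)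
  have \<sigma>: "\<sigma> P (homotopy_class X P (G \<circ> i)) = homotopy_class Y P G"
    if P: "ANR_space P" and G: "continuous_map Y P G" for P G
  proof -
    define G' where "G' = (SOME G'. continuous_map Y P G' \<and> G' \<circ> i \<in> homotopy_class X P (G \<circ> i))"
    have "G \<circ> i \<in> homotopy_class X P (G \<circ> i)"
      using continuous_map_compose [OF i G] by (simp only: mem_homotopy_class homotopic_with_refl)
    with G have "continuous_map Y P G \<and> G \<circ> i \<in> homotopy_class X P (G \<circ> i)" ..
    then have G': "continuous_map Y P G' \<and> G' \<circ> i \<in> homotopy_class X P (G \<circ> i)"
      unfolding G'_def by (rule someI [where P = "\<lambda>G'. continuous_map Y P G' \<and> G' \<circ> i \<in> homotopy_class X P (G \<circ> i)"])
    then have "homotopic_with (\<lambda>_. True) Y P G G'"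
      using inj [OF P G] unfolding mem_homotopy_class by blast
    moreover have "\<sigma> P (homotopy_class X P (G \<circ> i)) = homotopy_class Y P G'"
      by (simp only: \<sigma>_def G'_def)
    ultimately show ?thesis
      using homotopy_class_eq [OF G] by metis
  qed
  have rep: "\<exists>G. continuous_map Y P G \<and> c = homotopy_class X P (G \<circ> i)"
    if "ANR_space P" "c \<in> homotopy_classes X P" for P :: "'p topology" and c
  proof -
    from that(2) obtain g where g: "continuous_map X P g" "c = homotopy_class X P g"
      by (rule homotopy_classesE)
    from surj [OF that(1) g(1)] obtain G where G: "continuous_map Y P G" "homotopic_with (\<lambda>_. True) X P (G \<circ> i) g"
      by blast
    then have "c = homotopy_class X P (G \<circ> i)"
      using g homotopy_class_eq [OF g(1)] homotopic_with_symD by blast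
    with G(1) show ?thesis
      by blast
  qed
  have comp: "continuous_map X P (G \<circ> i)" if "continuous_map Y P G" for P and G :: "'y \<Rightarrow> 'p"
    using i that by (rule continuous_map_compose)
  have "shape_morphism X Y ?\<tau>"
    unfolding shape_morphism_def
  proof (intro conjI allI impI ballI funcsetI)
    show "?\<tau> P c \<in> homotopy_classes X P" if "c \<in> homotopy_classes Y P" for P c
      using that by (auto elim!: homotopy_classesE simp: \<tau> comp homotopy_class_in)
    show "?\<tau> Q (postcomp_class Y Q u c) = postcomp_class X Q u (?\<tau> P c)"
      if "ANR_space P \<and> ANR_space Q \<and> continuous_map P Q u" "c \<in> homotopy_classes Y P" for P Q u c
      using that by (auto elim!: homotopy_classesE
          simp: \<tau> comp postcomp_homotopy_class continuous_map_compose o_assoc)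
  qed
  moreover have "shape_morphism Y X \<sigma>"
    unfolding shape_morphism_def
  proof (intro conjI allI impI ballI funcsetI)
    show "\<sigma> P c \<in> homotopy_classes Y P" if "ANR_space P" "c \<in> homotopy_classes X P" for P c
      using rep [OF that] that(1) by (auto simp: \<sigma> homotopy_class_in)
    show "\<sigma> Q (postcomp_class X Q u c) = postcomp_class Y Q u (\<sigma> P c)"
      if "ANR_space P \<and> ANR_space Q \<and> continuous_map P Q u" "c \<in> homotopy_classes X P" for P Q u c
    proof -
      from that rep obtain G where G: "continuous_map Y P G" "c = homotopy_class X P (G \<circ> i)"
        by blast
      have "continuous_map Y Q (u \<circ> G)"
        using G(1) that by (blast intro: continuous_map_compose)
      then have "\<sigma> Q (homotopy_class X Q ((u \<circ> G) \<circ> i)) = homotopy_class Y Q (u \<circ> G)"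
        using \<sigma> that by blast
      then show ?thesis
        using that G by (simp add: \<sigma> comp postcomp_homotopy_class o_assoc)
    qed
  qed
  moreover have "shape_eq X (shape_comp \<sigma> ?\<tau>) shape_id"
    unfolding shape_eq_def shape_comp_def shape_id_def
    using rep by (metis \<sigma> \<tau>)
  moreover have "shape_eq Y (shape_comp ?\<tau> \<sigma>) shape_id"
    unfolding shape_eq_def shape_comp_def shape_id_def
    by (auto elim!: homotopy_classesE simp: \<tau> \<sigma>)
  ultimately show ?thesis
    unfolding shape_equivalence_def shape_isomorphism_def using i by blast
qed

section \<open>Homeomorphisms with small trapping regions\<close>

text \<open>In the application \<open>A\<close> is the basin and \<open>F\<close> an iterate of the
  given homeomorphism; \<open>G\<close> is a parameter because it serves as \<open>\<psi>\<close> in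
  the telescope. The last conjunct of \<open>trapping\<close> makes the preimages of
  \<open>T\<close> under the powers of \<open>F\<close> exhaust \<open>A\<close>.\<close>

locale trapping_homeomorphism =
  fixes A :: "'a topology" and F G :: "'a \<Rightarrow> 'a" and K :: "'a set"
  assumes ANR: "ANR_space A"
    and homeo: "homeomorphic_maps A A F G"
    and K: "closedin A K" "F ` K = K"
    and trapping: "\<And>W. openin A W \<Longrightarrow> K \<subseteq> W \<Longrightarrow> \<exists>T T'. closedin A T \<and> openin A T' \<and> K \<subseteq> T' \<and> T' \<subseteq> T \<and>
      T \<subseteq> W \<and> F ` T \<subseteq> T' \<and> (\<forall>x\<in>topspace A. \<exists>k. (F ^^ k) x \<in> T)"
    and homotopic: "homotopic_with (\<lambda>_. True) (subtopology A K) (subtopology A K) id F"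
begin

lemma metrizable: "metrizable_space A"
  using ANR by (simp add: ANR_space_def)

lemma continuous: "continuous_map A A F" "continuous_map A A G"
  and inverse: "\<And>x. x \<in> topspace A \<Longrightarrow> G (F x) = x"
  using homeo by (auto simp: homeomorphic_maps_def)

lemma K_subset: "K \<subseteq> topspace A"
  using K(1) by (rule closedin_subset)

lemma trapping_region:
  assumes "openin A W" "K \<subseteq> W"
  obtains T T' where "closedin A T" "openin A T'" "K \<subseteq> T'" "T' \<subseteq> T" "T \<subseteq> W" "F ` T \<subseteq> T'"
    "\<And>x. x \<in> topspace A \<Longrightarrow> \<exists>k. (F ^^ k) x \<in> T"
  using trapping [OF assms] by metis

section \<open>The homotopy between the identity and \<open>F\<close>\<close>

lemma homotopy_near:
  assumes h: "continuous_map (prod_topology I01 (subtopology A K)) (subtopology A K) h"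
    and h0: "\<And>x. x \<in> K \<Longrightarrow> h (0, x) = x" and h1: "\<And>x. x \<in> K \<Longrightarrow> h (1, x) = F x"
  obtains W H where "openin A W" "K \<subseteq> W" "continuous_map (prod_topology I01 (subtopology A W)) A H"
    "\<And>x. x \<in> W \<Longrightarrow> H (0, x) = x" "\<And>x. x \<in> W \<Longrightarrow> H (1, x) = F x"
    "\<And>t x. t \<in> {0..1} \<Longrightarrow> x \<in> K \<Longrightarrow> H (t, x) = h (t, x)"
proof -
  have id: "continuous_map A A (\<lambda>x. x)"
    by simp
  \<comment> \<open>\<open>K\<close> itself need not be an ANR, so the homotopy is regarded as one
    into \<open>A\<close> before it is extended.\<close>
  have h': "continuous_map (prod_topology I01 (subtopology A K)) A h"
    using h by (rule continuous_map_into_fulltopology)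
  show thesis
    by (rule nearby_homotopy [OF ANR metrizable K(1) id continuous(1) h' h0 h1]; (assumption | rule that))
qed

text \<open>On \<open>K\<close> this is \<open>commuting_homotopy\<close> followed by \<open>G = F\<^bsup>-1\<^esup>\<close>.\<close>

lemma conjugation_homotopy:
  assumes N: "closedin A N" "K \<subseteq> N" "F ` N \<subseteq> N"
    and H: "continuous_map (prod_topology I01 (subtopology A N)) A H"
      "\<And>x. x \<in> N \<Longrightarrow> H (0, x) = x" "\<And>x. x \<in> N \<Longrightarrow> H (1, x) = F x"
      "\<And>s x. s \<in> {0..1} \<Longrightarrow> x \<in> K \<Longrightarrow> H (s, x) \<in> K"
  obtains V J where "openin (subtopology A N) V" "K \<subseteq> V"
    "continuous_map (prod_topology I01 (prod_topology I01 (subtopology A V))) A J"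
    "\<And>s x. s \<in> {0..1} \<Longrightarrow> x \<in> V \<Longrightarrow> J (0, s, x) = G (H (s, F x))"
    "\<And>s x. s \<in> {0..1} \<Longrightarrow> x \<in> V \<Longrightarrow> J (1, s, x) = H (s, x)"
    "\<And>t x. t \<in> {0..1} \<Longrightarrow> x \<in> V \<Longrightarrow> J (t, 0, x) = x"
    "\<And>t x. t \<in> {0..1} \<Longrightarrow> x \<in> V \<Longrightarrow> J (t, 1, x) = F x"
proof -
  have NA: "N \<subseteq> topspace A"
    using N(1) by (rule closedin_subset)
  have FN: "F x \<in> N" if "x \<in> N" for x
    using N(3) that by blast
  have FK: "F x \<in> K" if "x \<in> K" for x
    using K(2) that by blast
  have topK: "topspace (subtopology A K) = K"
    using K_subset by auto
  have "continuous_map (prod_topology I01 (subtopology A K)) A H"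
    using H(1) N(2) unfolding prod_topology_subtopology
    by (blast intro: continuous_map_from_subtopology_mono)
  then have HK: "continuous_map (prod_topology I01 (subtopology A K)) (subtopology A K) H"
    using H(4) by (auto simp: continuous_map_in_subtopology topK)
  have HK0: "H (0, x) = x" if "x \<in> topspace (subtopology A K)" for x
    using H(2) that N(2) topK by blast
  obtain Q where Q: "continuous_map (prod_topology I01 (prod_topology I01 (subtopology A K))) (subtopology A K) Q"
    and Q0: "\<And>s x. s \<in> {0..1} \<Longrightarrow> x \<in> K \<Longrightarrow> Q (0, s, x) = H (s, H (1, x))"
    and Q1: "\<And>s x. s \<in> {0..1} \<Longrightarrow> x \<in> K \<Longrightarrow> Q (1, s, x) = H (1, H (s, x))"
    and Qs0: "\<And>t x. t \<in> {0..1} \<Longrightarrow> x \<in> K \<Longrightarrow> Q (t, 0, x) = H (1, x)"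
    and Qs1: "\<And>t x. t \<in> {0..1} \<Longrightarrow> x \<in> K \<Longrightarrow> Q (t, 1, x) = H (1, H (1, x))"
    by (rule commuting_homotopy [OF HK HK0, unfolded topK]) (assumption | rule that)+
  \<comment> \<open>The parameter \<open>s\<close> becomes part of the space \<open>X\<close>, so
    that a deformation of homotopies is a homotopy of maps from \<open>X\<close> to
    \<open>A\<close>.\<close>
  define X where "X = prod_topology I01 (subtopology A N)"
  have topX: "topspace X = {0..1} \<times> N"
    using NA by (auto simp: X_def)
  \<comment> \<open>Over \<open>K\<close> this is the commuting homotopy followed by
    \<open>G\<close>; for \<open>s = 0\<close> and \<open>s = 1\<close> it is constant in
    \<open>t\<close> with values \<open>x\<close> and \<open>F x\<close>. The pieces agree because
    \<open>G (F x) = x\<close>.\<close>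
  define k where "k z = (if snd (snd z) \<in> K then G (Q z) else if fst (snd z) = 0 then snd (snd z) else F (snd (snd z)))"
    for z :: "real \<times> real \<times> 'a"
  define e0 where "e0 y = G (H (fst y, F (snd y)))" for y :: "real \<times> 'a"
  let ?K = "({0} \<times> N \<union> {1} \<times> N) \<union> {0..1::real} \<times> K"
  have cN: "closedin (subtopology A N) K" "closedin (subtopology A N) N"
    using K(1) N(1,2) NA by (simp_all add: closedin_subset_topspace)
  have c0: "closedin X ({0} \<times> N)" and c1: "closedin X ({1} \<times> N)" and cK: "closedin X ({0..1} \<times> K)"
    unfolding X_def using cN by (simp_all add: closedin_prod_Times_iff closedin_I01)
  have kx: "k (t, s, x) = (if s = 0 then x else F x)" if "t \<in> {0..1}" "x \<in> N" "s = 0 \<or> s = 1" for t s x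
    using that Qs0 [of t x] Qs1 [of t x] H(3) FK [of x] inverse NA N(2) by (auto simp: k_def subset_iff)
  have kK: "k z = G (Q z)" if "snd (snd z) \<in> K" for z
    using that by (simp add: k_def)
  have XA: "continuous_map X A snd"
    unfolding X_def by (rule continuous_map_into_fulltopology [OF continuous_map_snd])
  have sndA: "continuous_map (prod_topology I01 (subtopology X S)) A (\<lambda>z. snd (snd z))" for S
    by (intro continuous_map_compose' [OF continuous_map_snd] continuous_map_from_subtopology XA)
  have k0: "continuous_map (prod_topology I01 (subtopology X ({0} \<times> N))) A k"
    by (rule continuous_map_eq [OF sndA]) (auto simp: kx topX)
  have k1: "continuous_map (prod_topology I01 (subtopology X ({1} \<times> N))) A k"
    by (rule continuous_map_eq [OF continuous_map_compose' [OF sndA continuous(1)]]) (auto simp: kx topX)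
  have "subtopology X ({0..1} \<times> K) = prod_topology I01 (subtopology A K)"
    unfolding X_def prod_topology_subtopology subtopology_subtopology using N(2)
    by (intro arg_cong [where f = "subtopology _"]) auto
  then have kK': "continuous_map (prod_topology I01 (subtopology X ({0..1} \<times> K))) A k"
    using continuous_map_compose' [OF continuous_map_into_fulltopology [OF Q] continuous(2)]
    by (auto simp: kK elim!: continuous_map_eq)
  have clo: "closedin X ?K"
    using c0 c1 cK by blast
  have kc: "continuous_map (prod_topology I01 (subtopology X ?K)) A k"
    by (intro continuous_map_prod_closed_Un closedin_Un c0 c1 cK k0 k1 kK')
  have "continuous_map X X (\<lambda>y. (fst y, F (snd y)))"
    unfolding X_def
  proof (rule continuous_map_pairedI [OF continuous_map_fst])
    show "continuous_map (prod_topology I01 (subtopology A N)) (subtopology A N) (\<lambda>y. F (snd y))"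
      using continuous_map_compose' [OF XA continuous(1)] FN by (auto simp: X_def continuous_map_in_subtopology)
  qed
  then have e0: "continuous_map X A e0"
    unfolding e0_def X_def by (intro continuous_map_compose' [OF _ continuous(2)] continuous_map_compose' [OF _ H(1)])
  have e1: "continuous_map X A H"
    using H(1) by (simp add: X_def)
  have ke0: "k (0, y) = e0 y" if "y \<in> ?K" for y
  proof (cases "snd y \<in> K")
    case True
    then show ?thesis
      using that Q0 [of "fst y" "snd y"] H(3) N(2) by (auto simp: k_def e0_def)
  next
    case False
    then show ?thesis
      using that kx [of 0 "snd y" "fst y"] H(2,3) FN inverse NA by (auto simp: e0_def subset_iff)
  qed
  have ke1: "k (1, y) = H y" if "y \<in> ?K" for y
  proof (cases "snd y \<in> K")
    case True
    then have "H y \<in> K" "fst y \<in> {0..1}"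
      using that H(4) by auto
    then show ?thesis
      using True Q1 [of "fst y" "snd y"] H(3) N(2) inverse K_subset by (cases y) (auto simp: k_def subset_iff)
  next
    case False
    then show ?thesis
      using that kx [of 1 "snd y" "fst y"] H(2,3) by auto
  qed
  have X: "metrizable_space X"
    unfolding X_def by (intro metrizable_space_prod_I01 metrizable_space_subtopology metrizable)
  obtain U J where U: "openin X U" "?K \<subseteq> U" and J: "continuous_map (prod_topology I01 (subtopology X U)) A J"
    and J0: "\<And>y. y \<in> U \<Longrightarrow> J (0, y) = e0 y" and J1: "\<And>y. y \<in> U \<Longrightarrow> J (1, y) = H y"
    and Jk: "\<And>t y. t \<in> {0..1} \<Longrightarrow> y \<in> ?K \<Longrightarrow> J (t, y) = k (t, y)"
    using nearby_homotopy [OF ANR X clo e0 e1 kc ke0 ke1] by blast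
  define V where "V = {x \<in> topspace (subtopology A N). \<forall>s\<in>topspace I01. (s, x) \<in> U}"
  have VN: "V \<subseteq> N"
    by (auto simp: V_def)
  have VU: "(s, x) \<in> U" if "s \<in> {0..1}" "x \<in> V" for s x
    using that by (auto simp: V_def)
  show thesis
  proof (rule that)
    show "openin (subtopology A N) V"
      unfolding V_def by (rule openin_tube [OF compact_space_I01]) (use U(1) in \<open>simp add: X_def\<close>)
    show "K \<subseteq> V"
      using U(2) N(2) K_subset by (auto simp: V_def)
    have "prod_topology I01 (subtopology A V) = subtopology X ({0..1} \<times> V)"
      unfolding X_def prod_topology_subtopology subtopology_subtopology using VN
      by (intro arg_cong [where f = "subtopology _"]) auto
    then have eq: "prod_topology I01 (prod_topology I01 (subtopology A V)) =
        subtopology (prod_topology I01 X) (topspace I01 \<times> ({0..1} \<times> V))"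
      by (simp only: prod_topology_subtopology)
    have "topspace I01 \<times> ({0..1} \<times> V) \<subseteq> topspace I01 \<times> U"
      using VU by auto
    then show "continuous_map (prod_topology I01 (prod_topology I01 (subtopology A V))) A J"
      unfolding eq by (rule continuous_map_from_subtopology_mono [OF J [unfolded prod_topology_subtopology(2)]])
    show "J (0, s, x) = G (H (s, F x))" "J (1, s, x) = H (s, x)" if "s \<in> {0..1}" "x \<in> V" for s x
      using J0 J1 VU [OF that] by (simp_all add: e0_def)
    show "J (t, 0, x) = x" "J (t, 1, x) = F x" if "t \<in> {0..1}" "x \<in> V" for t x
      using that VN Jk kx by auto
  qed
qed

text \<open>The telescope runs over the cylinder \<open>[0, 1] \<times> A\<close> with
  \<open>id \<times> F\<close>, \<open>\<psi> = G\<close> and the ends held fixed, starting from the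
  deformation of \<open>conjugation_homotopy\<close> on a trapping region. The result is traversed
  from \<open>F\<close> to the identity, since then \<open>J = g \<circ> R\<close> satisfies
  \<open>J (0, x) = J (1, F x)\<close>, as the telescope with \<open>\<psi> = id\<close>
  demands.\<close>

lemma global_homotopy:
  obtains R where "continuous_map (prod_topology I01 A) A R"
    "\<And>x. x \<in> topspace A \<Longrightarrow> R (0, x) = F x" "\<And>x. x \<in> topspace A \<Longrightarrow> R (1, x) = x"
    "\<And>t x. t \<in> {0..1} \<Longrightarrow> x \<in> K \<Longrightarrow> R (t, x) \<in> K"
proof -
  obtain h where h: "continuous_map (prod_topology I01 (subtopology A K)) (subtopology A K) h"
    and h01: "\<And>x. h (0, x) = x" "\<And>x. h (1, x) = F x"
    using homotopic by (auto simp: homotopic_with_def)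
  obtain W H where W: "openin A W" "K \<subseteq> W" and H: "continuous_map (prod_topology I01 (subtopology A W)) A H"
    and H0: "\<And>x. x \<in> W \<Longrightarrow> H (0, x) = x" and H1: "\<And>x. x \<in> W \<Longrightarrow> H (1, x) = F x"
    and Hh: "\<And>t x. t \<in> {0..1} \<Longrightarrow> x \<in> K \<Longrightarrow> H (t, x) = h (t, x)"
    by (rule homotopy_near [OF h h01]) (assumption | rule that)+
  have HK: "H (t, x) \<in> K" if "t \<in> {0..1}" "x \<in> K" for t x
    using h that K_subset by (auto simp: Hh continuous_map_def)
  \<comment> \<open>\<open>F\<close> maps \<open>N\<close> into itself, so \<open>H\<close> can be
    evaluated at \<open>F x\<close> for \<open>x \<in> N\<close>.\<close>
  obtain N N' where N: "closedin A N" "openin A N'" "K \<subseteq> N'" "N' \<subseteq> N" "N \<subseteq> W" "F ` N \<subseteq> N'"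
    using trapping_region [OF W] by metis
  have KN: "K \<subseteq> N" and FN: "F ` N \<subseteq> N"
    using N by auto
  obtain V J where V: "openin (subtopology A N) V" "K \<subseteq> V"
    and J: "continuous_map (prod_topology I01 (prod_topology I01 (subtopology A V))) A J"
    and J0: "\<And>s x. s \<in> {0..1} \<Longrightarrow> x \<in> V \<Longrightarrow> J (0, s, x) = G (H (s, F x))"
    and J1: "\<And>s x. s \<in> {0..1} \<Longrightarrow> x \<in> V \<Longrightarrow> J (1, s, x) = H (s, x)"
    and Js0: "\<And>t x. t \<in> {0..1} \<Longrightarrow> x \<in> V \<Longrightarrow> J (t, 0, x) = x"
    and Js1: "\<And>t x. t \<in> {0..1} \<Longrightarrow> x \<in> V \<Longrightarrow> J (t, 1, x) = F x"
    by (rule conjugation_homotopy [OF N(1) KN FN continuous_map_prod_subtopology_mono [OF H N(5)]])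
      (use H0 H1 HK N(5) in \<open>assumption | blast\<close>)+
  obtain V\<^sub>0 where V\<^sub>0: "openin A V\<^sub>0" "V = V\<^sub>0 \<inter> N"
    using V(1) by (auto simp: openin_subtopology)
  then have "V \<inter> N' = V\<^sub>0 \<inter> N'"
    using N(4) by blast
  \<comment> \<open>\<open>V\<close> is only known to be open in \<open>N\<close>; inside the open
    set \<open>N'\<close> it is open in \<open>A\<close>.\<close>
  then have "openin A (V \<inter> N')"
    using V\<^sub>0(1) N(2) by auto
  moreover have "K \<subseteq> V \<inter> N'"
    using V(2) N(3) by blast
  ultimately obtain T T' where T: "closedin A T" "openin A T'" "K \<subseteq> T'" "T' \<subseteq> T" "T \<subseteq> V \<inter> N'" "F ` T \<subseteq> T'"
    and absorb: "\<And>x. x \<in> topspace A \<Longrightarrow> \<exists>k. (F ^^ k) x \<in> T"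
    by (rule trapping_region) (rule that)
  have TV: "T \<subseteq> V"
    using T(5) by auto
  define Y where "Y = prod_topology I01 A"
  define \<phi> where "\<phi> y = (fst y, F (snd y))" for y :: "real \<times> 'a"
  \<comment> \<open>Stationary at the ends: the identity for \<open>s = 0\<close> and
    \<open>F\<close> for \<open>s = 1\<close>. Both solve the telescope equation because
    \<open>G (F x) = x\<close>.\<close>
  define b where "b z = (if fst (snd z) = 0 then snd (snd z) else F (snd (snd z)))" for z :: "real \<times> real \<times> 'a"
  let ?B = "{0} \<times> topspace A \<union> {1::real} \<times> topspace A"
  have Y: "metrizable_space Y"
    unfolding Y_def by (intro metrizable_space_prod_I01 metrizable)
  have \<phi>: "continuous_map Y Y \<phi>"
    unfolding Y_def \<phi>_def
    by (intro continuous_map_pairedI continuous_map_fst continuous_map_compose' [OF continuous_map_snd continuous(1)])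
  have \<phi>_pow: "(\<phi> ^^ k) (s, x) = (s, (F ^^ k) x)" for k s x
    by (induction k) (auto simp: \<phi>_def)
  have TY: "closedin Y ({0..1} \<times> T)" "openin Y ({0..1} \<times> T')" "{0..1} \<times> T' \<subseteq> {0..1::real} \<times> T"
    "\<phi> ` ({0..1} \<times> T) \<subseteq> {0..1} \<times> T'"
    using T openin_topspace [of I01] by (auto simp: Y_def \<phi>_def closedin_prod_Times_iff openin_prod_Times_iff closedin_I01)
  have absorbY: "\<exists>k. (\<phi> ^^ k) y \<in> {0..1} \<times> T" if "y \<in> topspace Y" for y
    using that absorb by (auto simp: Y_def \<phi>_pow)
  have B0: "closedin Y ({0} \<times> topspace A)" and B1: "closedin Y ({1} \<times> topspace A)"
    by (auto simp: Y_def closedin_prod_Times_iff closedin_I01)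
  have FA: "F x \<in> topspace A" if "x \<in> topspace A" for x
    using continuous(1) that by (auto simp: continuous_map_def)
  have B: "closedin Y ?B" "\<phi> ` ?B \<subseteq> ?B"
    using B0 B1 FA by (auto simp: \<phi>_def)
  have snd_snd: "continuous_map (prod_topology I01 (subtopology Y S)) A (\<lambda>z. snd (snd z))" for S
    unfolding Y_def
    by (intro continuous_map_compose' [OF continuous_map_snd] continuous_map_from_subtopology continuous_map_snd)
  have b: "continuous_map (prod_topology I01 (subtopology Y ?B)) A b"
  proof (rule continuous_map_prod_closed_Un [OF B0 B1])
    show "continuous_map (prod_topology I01 (subtopology Y ({0} \<times> topspace A))) A b"
      by (rule continuous_map_eq [OF snd_snd]) (auto simp: b_def)
    show "continuous_map (prod_topology I01 (subtopology Y ({1} \<times> topspace A))) A b"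
      by (rule continuous_map_eq [OF continuous_map_compose' [OF snd_snd continuous(1)]]) (auto simp: b_def)
  qed
  have b_eq: "b (0, y) = G (b (1, \<phi> y))" if "y \<in> ?B" for y
    using that inverse FA by (auto simp: b_def \<phi>_def)
  have "continuous_map (prod_topology I01 (prod_topology I01 (subtopology A T))) A J"
    using J TV unfolding prod_topology_subtopology by (auto intro: continuous_map_from_subtopology_mono)
  then have JT: "continuous_map (prod_topology I01 (subtopology Y ({0..1} \<times> T))) A J"
    by (simp add: Y_def prod_topology_subtopology)
  have J_eq: "J (0, y) = G (J (1, \<phi> y))" if "y \<in> {0..1} \<times> T" for y
    using that J0 J1 TV T(4,6) by (auto simp: \<phi>_def subset_iff)
  have J_b: "J (t, y) = b (t, y)" if "t \<in> {0..1}" "y \<in> ({0..1} \<times> T) \<inter> ?B" for t y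
    using that Js0 [of t "snd y"] Js1 [of t "snd y"] TV by (auto simp: b_def)
  obtain L where L: "continuous_map (prod_topology I01 Y) A L"
    and Lb: "\<And>t y. t \<in> {0..1} \<Longrightarrow> y \<in> ?B \<Longrightarrow> L (t, y) = b (t, y)"
    and LJ: "\<And>t y. t \<in> {0..1} \<Longrightarrow> y \<in> {0..1} \<times> T \<Longrightarrow> L (t, y) = J (t, y)"
    by (rule telescope_extension [OF ANR Y \<phi> TY absorbY B continuous(2) b b_eq JT J_eq J_b]) (assumption | rule that)+
  have fs: "continuous_map (prod_topology I01 A) euclideanreal fst"
    by (rule continuous_map_into_fulltopology [OF continuous_map_fst])
  have rev: "continuous_map (prod_topology I01 A) Y (\<lambda>z. (1 - fst z, snd z))"
    unfolding Y_def
    by (intro continuous_map_pairedI continuous_map_snd continuous_map_into_subtopology continuous_map_diff fs)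
      (auto simp: continuous_map_const)
  show thesis
  proof (rule that)
    \<comment> \<open>The slice of \<open>L\<close> at time 1 agrees with \<open>H\<close> on the
      trapping region, which is why it maps \<open>K\<close> into itself.\<close>
    show "continuous_map (prod_topology I01 A) A (\<lambda>z. L (1, 1 - fst z, snd z))"
      by (rule continuous_map_compose' [OF _ L]) (auto intro!: continuous_map_pairedI rev)
    show "L (1, 1 - fst (0, x), snd (0, x)) = F x" "L (1, 1 - fst (1, x), snd (1, x)) = x" if "x \<in> topspace A" for x
      using that Lb by (auto simp: b_def)
    show "L (1, 1 - fst (t, x), snd (t, x)) \<in> K" if "t \<in> {0..1}" "x \<in> K" for t x
    proof -
      have "x \<in> T" "x \<in> V"
        using that T(3,4) V(2) by auto
      then show ?thesis
        using that LJ J1 HK by simp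
    qed
  qed
qed

section \<open>Restriction of maps and homotopies to \<open>K\<close>\<close>

text \<open>Extend \<open>g\<close> to \<open>u\<close> near \<open>K\<close> and follow
  \<open>R\<close>: \<open>u \<circ> R\<close> starts at \<open>u \<circ> F\<close> and ends at
  \<open>u\<close>, so it solves the telescope equation on a trapping region. The final map of the
  extended homotopy equals \<open>u\<close> there, hence extends \<open>g\<close> exactly and not
  only up to homotopy.\<close>

lemma restriction_surjective:
  assumes P: "ANR_space P" and g: "continuous_map (subtopology A K) P g"
  obtains g' where "continuous_map A P g'" "\<And>x. x \<in> K \<Longrightarrow> g' x = g x"
proof -
  obtain U u where U: "openin A U" "K \<subseteq> U" "continuous_map (subtopology A U) P u" and ug: "\<And>x. x \<in> K \<Longrightarrow> u x = g x"
    by (rule ANR_space_extension [OF P metrizable K(1) g]) (rule that)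
  obtain R where R: "continuous_map (prod_topology I01 A) A R"
    and R0: "\<And>x. x \<in> topspace A \<Longrightarrow> R (0, x) = F x" and R1: "\<And>x. x \<in> topspace A \<Longrightarrow> R (1, x) = x"
    and RK: "\<And>t x. t \<in> {0..1} \<Longrightarrow> x \<in> K \<Longrightarrow> R (t, x) \<in> K"
    by (rule global_homotopy) (rule that)
  \<comment> \<open>\<open>V\<close> consists of the points whose whole track under \<open>R\<close>
    stays in the domain \<open>U\<close> of \<open>u\<close>; it contains \<open>K\<close> because
    \<open>R\<close> maps \<open>K\<close> into itself.\<close>
  define V where "V = {x \<in> topspace A. \<forall>t\<in>topspace I01. (t, x) \<in> {z \<in> topspace (prod_topology I01 A). R z \<in> U}}"
  have "openin A V"
    unfolding V_def by (intro openin_tube [OF compact_space_I01] openin_continuous_map_preimage [OF R U(1)])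
  moreover have "K \<subseteq> V"
    using RK U(2) K_subset by (auto simp: V_def)
  ultimately obtain T T' where T: "closedin A T" "openin A T'" "K \<subseteq> T'" "T' \<subseteq> T" "T \<subseteq> V" "F ` T \<subseteq> T'"
    and absorb: "\<And>x. x \<in> topspace A \<Longrightarrow> \<exists>k. (F ^^ k) x \<in> T"
    by (rule trapping_region) (rule that)
  have TA: "T \<subseteq> topspace A"
    using T(1) closedin_subset by auto
  have "continuous_map (prod_topology I01 (subtopology A T)) A R"
    using R unfolding prod_topology_subtopology by (rule continuous_map_from_subtopology)
  then have "continuous_map (prod_topology I01 (subtopology A T)) (subtopology A U) R"
    using T(5) by (auto simp: continuous_map_in_subtopology V_def)
  then have J0: "continuous_map (prod_topology I01 (subtopology A T)) P (\<lambda>z. u (R z))"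
    using U(3) by (rule continuous_map_compose')
  have J0_eq: "u (R (0, y)) = id (u (R (1, F y)))" if "y \<in> T" for y
    using that TA T(4,6) R0 R1 by (auto simp: subset_iff)
  have b: "continuous_map (prod_topology I01 (subtopology A {})) P undefined"
    by (simp add: continuous_map_def)
  obtain J where J: "continuous_map (prod_topology I01 A) P J"
    and JJ0: "\<And>t y. t \<in> {0..1} \<Longrightarrow> y \<in> T \<Longrightarrow> J (t, y) = u (R (t, y))"
    by (rule telescope_extension [where B = "{}" and \<psi> = id, OF P metrizable continuous(1)
          T(1,2,4,6) absorb _ _ _ b _ J0 J0_eq]) (assumption | rule that | simp)+
  show thesis
  proof (rule that)
    show "continuous_map A P (\<lambda>x. J (1, x))"
      by (rule continuous_map_compose' [OF _ J]) (auto intro!: continuous_map_pairedI)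
    show "J (1, x) = g x" if "x \<in> K" for x
      using JJ0 [of 1 x] R1 [of x] ug that T(3,4) K_subset by (auto simp: subset_iff)
  qed
qed

text \<open>Spread the homotopy on \<open>K\<close> to a homotopy \<open>E\<close> near
  \<open>K\<close>. Then \<open>E\<^sub>s \<circ> R\<^sub>t\<close> solves the telescope equation
  over a trapping region, while \<open>g0 \<circ> R\<^sub>t\<close> and
  \<open>g1 \<circ> R\<^sub>t\<close> solve it on all of \<open>A\<close> and prescribe the ends
  \<open>s = 0, 1\<close>. Since \<open>R\<^sub>1\<close> is the identity, the extension at time 1
  joins \<open>g0\<close> to \<open>g1\<close>.\<close>

lemma restriction_injective:
  assumes P: "ANR_space P" and g0: "continuous_map A P g0" and g1: "continuous_map A P g1"
    and k: "homotopic_with (\<lambda>_. True) (subtopology A K) P g0 g1"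
  shows "homotopic_with (\<lambda>_. True) A P g0 g1"
proof -
  obtain k where k: "continuous_map (prod_topology I01 (subtopology A K)) P k"
    and k0: "\<And>x. x \<in> K \<Longrightarrow> k (0, x) = g0 x" and k1: "\<And>x. x \<in> K \<Longrightarrow> k (1, x) = g1 x"
    using k by (auto simp: homotopic_with_def)
  obtain W E where W: "openin A W" "K \<subseteq> W" and E: "continuous_map (prod_topology I01 (subtopology A W)) P E"
    and E0: "\<And>x. x \<in> W \<Longrightarrow> E (0, x) = g0 x" and E1: "\<And>x. x \<in> W \<Longrightarrow> E (1, x) = g1 x"
    by (rule nearby_homotopy [OF P metrizable K(1) g0 g1 k k0 k1]) (assumption | rule that)+
  obtain R where R: "continuous_map (prod_topology I01 A) A R"
    and R0: "\<And>x. x \<in> topspace A \<Longrightarrow> R (0, x) = F x" and R1: "\<And>x. x \<in> topspace A \<Longrightarrow> R (1, x) = x"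
    and RK: "\<And>t x. t \<in> {0..1} \<Longrightarrow> x \<in> K \<Longrightarrow> R (t, x) \<in> K"
    by (rule global_homotopy) (rule that)
  define V where "V = {x \<in> topspace A. \<forall>t\<in>topspace I01. (t, x) \<in> {z \<in> topspace (prod_topology I01 A). R z \<in> W}}"
  have "openin A V"
    unfolding V_def by (intro openin_tube [OF compact_space_I01] openin_continuous_map_preimage [OF R W(1)])
  moreover have "K \<subseteq> V"
    using RK W(2) K_subset by (auto simp: V_def)
  ultimately obtain T T' where T: "closedin A T" "openin A T'" "K \<subseteq> T'" "T' \<subseteq> T" "T \<subseteq> V" "F ` T \<subseteq> T'"
    and absorb: "\<And>x. x \<in> topspace A \<Longrightarrow> \<exists>k. (F ^^ k) x \<in> T"
    by (rule trapping_region) (rule that)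
  have TA: "T \<subseteq> topspace A"
    using T(1) closedin_subset by auto
  have RW: "R (t, x) \<in> W" if "t \<in> {0..1}" "x \<in> T" for t x
    using that T(5) by (auto simp: V_def)
  have FT: "F x \<in> T" if "x \<in> T" for x
    using that T(4,6) by blast
  define Y where "Y = prod_topology I01 A"
  define \<phi> where "\<phi> y = (fst y, F (snd y))" for y :: "real \<times> 'a"
  define b where "b z = (if fst (snd z) = 0 then g0 (R (fst z, snd (snd z))) else g1 (R (fst z, snd (snd z))))"
    for z :: "real \<times> real \<times> 'a"
  define J where "J z = E (fst (snd z), R (fst z, snd (snd z)))" for z :: "real \<times> real \<times> 'a"
  let ?B = "{0} \<times> topspace A \<union> {1::real} \<times> topspace A"
  have Y: "metrizable_space Y"
    unfolding Y_def by (intro metrizable_space_prod_I01 metrizable)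
  have \<phi>: "continuous_map Y Y \<phi>"
    unfolding Y_def \<phi>_def
    by (intro continuous_map_pairedI continuous_map_fst continuous_map_compose' [OF continuous_map_snd continuous(1)])
  have \<phi>_pow: "(\<phi> ^^ k) (s, x) = (s, (F ^^ k) x)" for k s x
    by (induction k) (auto simp: \<phi>_def)
  have TY: "closedin Y ({0..1} \<times> T)" "openin Y ({0..1} \<times> T')" "{0..1} \<times> T' \<subseteq> {0..1::real} \<times> T"
    "\<phi> ` ({0..1} \<times> T) \<subseteq> {0..1} \<times> T'"
    using T openin_topspace [of I01] by (auto simp: Y_def \<phi>_def closedin_prod_Times_iff openin_prod_Times_iff closedin_I01)
  have absorbY: "\<exists>k. (\<phi> ^^ k) y \<in> {0..1} \<times> T" if "y \<in> topspace Y" for y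
    using that absorb by (auto simp: Y_def \<phi>_pow)
  have B0: "closedin Y ({0} \<times> topspace A)" and B1: "closedin Y ({1} \<times> topspace A)"
    by (auto simp: Y_def closedin_prod_Times_iff closedin_I01)
  have FA: "F x \<in> topspace A" if "x \<in> topspace A" for x
    using continuous(1) that by (auto simp: continuous_map_def)
  have B: "closedin Y ?B" "\<phi> ` ?B \<subseteq> ?B"
    using B0 B1 FA by (auto simp: \<phi>_def)
  have "continuous_map (prod_topology I01 Y) (prod_topology I01 A) (\<lambda>z. (fst z, snd (snd z)))"
    unfolding Y_def
    by (intro continuous_map_pairedI continuous_map_fst continuous_map_compose' [OF continuous_map_snd] continuous_map_snd)
  then have RY: "continuous_map (prod_topology I01 Y) A (\<lambda>z. R (fst z, snd (snd z)))"
    using R by (rule continuous_map_compose')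
  have gR: "continuous_map (prod_topology I01 (subtopology Y S)) P (\<lambda>z. g (R (fst z, snd (snd z))))"
    if "continuous_map A P g" for S g
    using continuous_map_compose' [OF RY that] unfolding prod_topology_subtopology
    by (rule continuous_map_from_subtopology)
  have b: "continuous_map (prod_topology I01 (subtopology Y ?B)) P b"
  proof (rule continuous_map_prod_closed_Un [OF B0 B1])
    show "continuous_map (prod_topology I01 (subtopology Y ({0} \<times> topspace A))) P b"
      by (rule continuous_map_eq [OF gR [OF g0]]) (auto simp: b_def)
    show "continuous_map (prod_topology I01 (subtopology Y ({1} \<times> topspace A))) P b"
      by (rule continuous_map_eq [OF gR [OF g1]]) (auto simp: b_def)
  qed
  have b_eq: "b (0, y) = id (b (1, \<phi> y))" if "y \<in> ?B" for y
    using that FA R0 R1 by (auto simp: b_def \<phi>_def)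
  let ?Z = "prod_topology I01 (subtopology Y ({0..1} \<times> T))"
  have "continuous_map ?Z A (\<lambda>z. R (fst z, snd (snd z)))"
    using RY unfolding prod_topology_subtopology by (rule continuous_map_from_subtopology)
  then have 1: "continuous_map ?Z (subtopology A W) (\<lambda>z. R (fst z, snd (snd z)))"
    using RW by (auto simp: continuous_map_in_subtopology)
  have "continuous_map (prod_topology I01 Y) I01 (\<lambda>z. fst (snd z))"
    unfolding Y_def by (intro continuous_map_compose' [OF continuous_map_snd] continuous_map_fst)
  then have 2: "continuous_map ?Z I01 (\<lambda>z. fst (snd z))"
    unfolding prod_topology_subtopology by (rule continuous_map_from_subtopology)
  have J: "continuous_map ?Z P J"
    unfolding J_def by (rule continuous_map_compose' [OF continuous_map_pairedI [OF 2 1] E])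
  have J_eq: "J (0, y) = id (J (1, \<phi> y))" if "y \<in> {0..1} \<times> T" for y
    using that R0 R1 FT TA by (auto simp: J_def \<phi>_def subset_iff)
  have J_b: "J (t, y) = b (t, y)" if "t \<in> {0..1}" "y \<in> ({0..1} \<times> T) \<inter> ?B" for t y
    using that E0 [OF RW] E1 [OF RW] by (auto simp: J_def b_def)
  obtain L where L: "continuous_map (prod_topology I01 Y) P L"
    and Lb: "\<And>t y. t \<in> {0..1} \<Longrightarrow> y \<in> ?B \<Longrightarrow> L (t, y) = b (t, y)"
    by (rule telescope_extension [OF P Y \<phi> TY absorbY B continuous_map_id b b_eq J J_eq J_b]) (assumption | rule that)+
  have "continuous_map Y P (\<lambda>y. L (1, y))"
    by (rule continuous_map_compose' [OF _ L]) (auto intro!: continuous_map_pairedI)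
  moreover have "L (1, 0, x) = g0 x" "L (1, 1, x) = g1 x" if "x \<in> topspace A" for x
    using that Lb R1 by (auto simp: b_def)
  ultimately show ?thesis
    unfolding Y_def by (subst homotopic_with) auto
qed

end

section \<open>Attractors\<close>

text \<open>A compact neighbourhood \<open>N\<close> of \<open>K\<close> in the basin is carried
  into an open \<open>V \<subseteq> N\<close> around \<open>K\<close> by all high iterates of
  \<open>f\<close>. One of them serves as \<open>F\<close>, and the images of \<open>N\<close> and
  \<open>V\<close> under powers of \<open>F\<close> are the trapping regions.\<close>

lemma attractor_trapping_homeomorphism:
  fixes M :: "'a topology"
  assumes lc: "locally_compact_space M" and ANR: "ANR_space M" and f: "homeomorphic_map M M f"
    and att: "attractor M f K"
    and hom: "homotopic_with (\<lambda>_. True) (subtopology M K) (subtopology M K) f id"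
  shows "\<exists>F G. trapping_homeomorphism (subtopology M (basin M f K)) F G K"
proof -
  have met: "metrizable_space M"
    using ANR by (simp add: ANR_space_def)
  define U where "U = basin M f K"
  note basin = basin_greatest [OF lc met f att, folded U_def]
  have cK: "compactin M K" and fK: "f ` K = K"
    using att by (auto simp: attractor_def)
  have UM: "U \<subseteq> topspace M"
    using basin(3) openin_subset by blast
  have KU: "K \<subseteq> U"
    using basin(1) by (auto simp: attracted_nbhd_def nbhd_of_def)
  define A where "A = subtopology M U"
  have "metrizable_space A"
    unfolding A_def using met by (rule metrizable_space_subtopology)
  then have HA: "Hausdorff_space A"
    by (rule metrizable_imp_Hausdorff_space)
  have "locally_compact_space A"
    unfolding A_def using lc basin(3) metrizable_imp_Hausdorff_space [OF met]
    by (intro locally_compact_space_open_subset) auto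
  moreover have cKA: "compactin A K"
    using cK KU by (simp add: A_def compactin_subtopology)
  ultimately obtain V N where V: "openin A V" and N: "compactin A N" and KVN: "K \<subseteq> V" "V \<subseteq> N"
    using locally_compact_space_compact_closed_compact [of A] HA by metis
  have openA: "openin M W \<and> W \<subseteq> U" if "openin A W" for W
    using that basin(3) by (simp add: A_def openin_open_subtopology)
  have nbhd: "nbhd_of M K W" if "openin A W" "K \<subseteq> W" for W
    using openA [OF that(1)] that(2) openin_subset by (force simp: nbhd_of_def)
  have attract: "\<exists>n0. \<forall>n\<ge>n0. (f ^^ n) ` C \<subseteq> W" if "compactin A C" "openin A W" "K \<subseteq> W" for C W
    using basin(1) nbhd [OF that(2,3)] that(1) unfolding attracted_nbhd_def A_def compactin_subtopology by blast
  obtain m where m: "\<And>n. n \<ge> m \<Longrightarrow> (f ^^ n) ` N \<subseteq> V"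
    using attract [OF N V KVN(1)] by blast
  \<comment> \<open>The exponent is at least \<open>m\<close>, so \<open>F\<close> maps
    \<open>N\<close> into \<open>V\<close>. It is also positive, so \<open>F ^^ j\<close> is an
    iterate of \<open>f\<close> of order at least \<open>j\<close>, even when
    \<open>m = 0\<close>.\<close>
  define F where "F = f ^^ Suc m"
  have Fk: "F ^^ k = f ^^ (Suc m * k)" for k
    by (simp add: F_def funpow_mult mult.commute del: funpow.simps mult_Suc)
  have "homeomorphic_map A A f"
    unfolding A_def using f basin(4) UM
    by (intro homeomorphic_map_subtopologies) (auto simp: Int_absorb1)
  then have homf: "homeomorphic_map A A (f ^^ n)" for n
    by (induction n) (auto simp: homeomorphic_map_id intro: homeomorphic_map_compose simp del: o_apply comp_apply)
  have fnK: "(f ^^ n) ` K = K" for n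
    by (induction n) (auto simp: image_comp [symmetric] fK simp del: o_apply comp_apply)
  obtain G where G: "homeomorphic_maps A A F G"
    using homf homeomorphic_map_maps unfolding F_def by blast
  have "trapping_homeomorphism A F G K"
  proof
    show "ANR_space A"
      unfolding A_def by (rule ANR_space_openin [OF ANR basin(3)])
    show "homeomorphic_maps A A F G"
      by fact
    show "closedin A K"
      using HA cKA by (rule compactin_imp_closedin)
    show "F ` K = K"
      unfolding F_def by (rule fnK)
    have sub: "subtopology A K = subtopology M K"
      using KU by (simp add: A_def subtopology_subtopology Int_absorb1)
    have "homotopic_with (\<lambda>_. True) (subtopology M K) (subtopology M K) (f ^^ n) id" for n
    proof (induction n)
      case (Suc n)
      show ?case
        using homotopic_compose [OF Suc hom] by (simp add: comp_def)
    qed simp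
    then show "homotopic_with (\<lambda>_. True) (subtopology A K) (subtopology A K) id F"
      unfolding sub F_def by (rule homotopic_with_symD)
  next
    fix W
    assume W: "openin A W" "K \<subseteq> W"
    obtain j where j: "\<And>n. n \<ge> j \<Longrightarrow> (f ^^ n) ` N \<subseteq> W"
      using attract [OF N W] by blast
    let ?T = "(F ^^ j) ` N" and ?T' = "(F ^^ j) ` V"
    have homF: "homeomorphic_map A A (F ^^ j)"
      unfolding Fk by (rule homf)
    have T': "openin A ?T'"
      using homeomorphic_map_openness_eq [OF homF] V by blast
    have KT': "K \<subseteq> ?T'"
      using image_mono [OF KVN(1), of "F ^^ j"] fnK by (simp add: Fk)
    show "\<exists>T T'. closedin A T \<and> openin A T' \<and> K \<subseteq> T' \<and> T' \<subseteq> T \<and> T \<subseteq> W \<and> F ` T \<subseteq> T' \<and>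
      (\<forall>x\<in>topspace A. \<exists>k. (F ^^ k) x \<in> T)"
    proof (rule exI [of _ ?T], rule exI [of _ ?T'], intro conjI ballI)
      show "closedin A ?T"
        using N homF homeomorphic_imp_continuous_map image_compactin compactin_imp_closedin HA by metis
      show "openin A ?T'" "K \<subseteq> ?T'" "?T' \<subseteq> ?T"
        using T' KT' KVN(2) by auto
      show "?T \<subseteq> W"
        unfolding Fk by (rule j) simp
      have "F ` ?T = (F ^^ j) ` (F ` N)"
        by (simp add: image_image funpow_swap1)
      also have "\<dots> \<subseteq> ?T'"
        using m [of "Suc m"] by (intro image_mono) (simp add: F_def)
      finally show "F ` ?T \<subseteq> ?T'" .
      fix x
      assume "x \<in> topspace A"
      \<comment> \<open>A single point is a compact subset of the basin, so it is attracted by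
        \<open>K\<close> and enters the neighbourhood \<open>?T'\<close>.\<close>
      then have "compactin A {x}"
        by simp
      then obtain n where "\<And>i. i \<ge> n \<Longrightarrow> (f ^^ i) ` {x} \<subseteq> ?T'"
        using attract T' KT' by meson
      then have "(F ^^ n) x \<in> ?T'"
        unfolding Fk [of n] by auto
      then show "\<exists>k. (F ^^ k) x \<in> ?T"
        using KVN(2) by blast
    qed
  qed
  then show ?thesis
    unfolding A_def U_def by blast
qed

theorem corollary4:
  fixes M :: "'a topology" and f :: "'a \<Rightarrow> 'a" and K :: "'a set"
  assumes "locally_compact_space M"
    and "ANR_space M"
    and "homeomorphic_map M M f"
    and "attractor M f K"
    and "homotopic_with (\<lambda>_. True) (subtopology M K) (subtopology M K) f id"
  shows "shape_equivalence TYPE('p) (subtopology M K) (subtopology M (basin M f K)) (\<lambda>x. x)"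
proof -
  define A where "A = subtopology M (basin M f K)"
  obtain F G where "trapping_homeomorphism A F G K"
    using attractor_trapping_homeomorphism [OF assms] unfolding A_def by blast
  then interpret trapping_homeomorphism A F G K .
  have "K \<subseteq> basin M f K"
    using K_subset by (simp add: A_def)
  then have sub: "subtopology M K = subtopology A K"
    by (simp add: A_def subtopology_subtopology Int_absorb1)
  have "shape_equivalence TYPE('p) (subtopology A K) A (\<lambda>x. x)"
  proof (rule shape_equivalence_if_bijective)
    show "continuous_map (subtopology A K) A (\<lambda>x. x)"
      by (simp add: continuous_map_from_subtopology)
  next
    fix P :: "'p topology" and g
    assume P: "ANR_space P" and g: "continuous_map (subtopology A K) P g"
    obtain g' where "continuous_map A P g'" "\<And>x. x \<in> K \<Longrightarrow> g' x = g x"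
      by (rule restriction_surjective [OF P g]) (rule that)
    moreover from this have "homotopic_with (\<lambda>_. True) (subtopology A K) P (g' \<circ> (\<lambda>x. x)) g"
      using g by (intro homotopic_with_symD [OF homotopic_with_equal]) auto
    ultimately show "\<exists>G. continuous_map A P G \<and> homotopic_with (\<lambda>_. True) (subtopology A K) P (G \<circ> (\<lambda>x. x)) g"
      by blast
  next
    fix P :: "'p topology" and g g'
    assume "ANR_space P" "continuous_map A P g" "continuous_map A P g'"
      "homotopic_with (\<lambda>_. True) (subtopology A K) P (g \<circ> (\<lambda>x. x)) (g' \<circ> (\<lambda>x. x))"
    then show "homotopic_with (\<lambda>_. True) A P g g'"
      by (simp add: comp_def restriction_injective)
  qed
  then show ?thesis
    by (simp add: A_def [symmetric] sub)
qed

end
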